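(* Every absolute-valued algebra $A$ with left-unit satisfying $(x^2, x^2, x^2) = 0$ is finite-dimensional of degree $\leq 4$. Concretely: (1) If $\deg(A) \leq 2$, then $A$ is isomorphic to either $\mathbb{R}$, $\mathbb{C}$, ${}^*\mathbb{C}$, $\mathbb{H}$, ${}^*\mathbb{H}$, $\mathbb{O}$ or ${}^*\mathbb{O}$. (2) If $\deg(A) = 4$, then $A$ is isomorphic to either ${}^*\mathbb{H}(i, 1)$, ${}^*\mathbb{O}(i, 1)$, $\tilde{\mathbb{O}}$ or $\tilde{\mathbb{O}}(i)$.
   Context: An absolute-valued algebra is a nonzero real algebra $A$ with a space norm $\|\cdot\|$ such that $\|xy\| = \|x\|\,\|y\|$ for all $x,y\in A$; $(x,y,z) = (xy)z - x(yz)$ denotes the associator. A left-unit is an element $e$ with $ex = x$ for all $x$. The degree of a finite-dimensional algebra is the smallest $n$ such that every subalgebra generated by a single element has dimension $\leq n$. For $\mathbb{A}\in\{\mathbb{C},\mathbb{H},\mathbb{O}\}$ (complexes, quaternions, octonions) with standard involution $x\mapsto\bar{x}$, ${}^*\mathbb{A}$ denotes the normed space of $\mathbb{A}$ with product $x\odot y = \bar{x}y$. ${}^*\mathbb{H}(i,1)$ is the normed space $\mathbb{H}$ with product $x\odot y = \bar{x}\, i\, y$. ${}^*\mathbb{O}(i,1)$ is the normed space $\mathbb{O}$ with product $x\odot y = (\bar{x} i)y$. On $\mathbb{H}\times\mathbb{H}$ let $\bullet$ be the Cayley–Dickson product $(x,y)\bullet(u,v) = (xu - \bar{v}y,\; y\bar{u}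 + vx)$ (so $(\mathbb{H}\times\mathbb{H},\bullet)=\mathbb{O}$). $\tilde{\mathbb{O}}$ is $\mathbb{H}\times\mathbb{H}$ with product $(x,y)\odot(u,v) = (\bar{x}, y)\bullet(u,v)$, and $\tilde{\mathbb{O}}(i)$ is $\mathbb{H}\times\mathbb{H}$ with product $(x,y)\odot(u,v) = (i\bar{x}\bar{i},\; iyi)\bullet(u,v)$; both have left-unit $(1,0)$. *)

theory Defs
  imports "HOL-Analysis.Analysis"
begin

definition absolute_valued_algebra :: "('a::real_normed_vector \<Rightarrow> 'a \<Rightarrow> 'a) \<Rightarrow> bool" where
  "absolute_valued_algebra m \<longleftrightarrow>
     bilinear m \<and> (\<exists>x::'a. x \<noteq> 0) \<and> (\<forall>x y. norm (m x y) = norm x * norm y)"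

definition has_left_unit :: "('a \<Rightarrow> 'a \<Rightarrow> 'a) \<Rightarrow> bool" where
  "has_left_unit m \<longleftrightarrow> (\<exists>e. \<forall>x. m e x = x)"

definition associator :: "('a \<Rightarrow> 'a \<Rightarrow> 'a) \<Rightarrow> 'a \<Rightarrow> 'a \<Rightarrow> 'a \<Rightarrow> 'a::ab_group_add" where
  "associator m x y z = m (m x y) z - m x (m y z)"

definition finite_dimensional :: "'a::real_vector itself \<Rightarrow> bool" where
  "finite_dimensional _ \<longleftrightarrow> (\<exists>B::'a set. finite B \<and> span B = UNIV)"

definition subalg_gen :: "('a::real_vector \<Rightarrow> 'a \<Rightarrow> 'a) \<Rightarrow> 'a set \<Rightarrow> 'a set" where
  "subalg_gen m S = \<Inter>{B. subspace B \<and> S \<subseteq> B \<and> (\<forall>a\<in>B. \<forall>b\<in>B. m a b \<in> B)}"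

text \<open>Degree: the smallest n such that every single-generated subalgebra has
dimension at most n (meaningful for finite-dimensional algebras).\<close>
definition degree :: "('a::real_vector \<Rightarrow> 'a \<Rightarrow> 'a) \<Rightarrow> nat" where
  "degree m = (LEAST n. \<forall>x. dim (subalg_gen m {x}) \<le> n)"

definition alg_isomorphic :: "('a::real_vector \<Rightarrow> 'a \<Rightarrow> 'a) \<Rightarrow> ('b::real_vector \<Rightarrow> 'b \<Rightarrow> 'b) \<Rightarrow> bool" where
  "alg_isomorphic m1 m2 \<longleftrightarrow>
     (\<exists>f::'a \<Rightarrow> 'b. linear f \<and> bij f \<and> (\<forall>x y. f (m1 x y) = m2 (f x) (f y)))"

text \<open>Quaternions: \<open>\<complex> \<times> \<complex>\<close> with \<open>(x,y)(u,v) = (xu - cnj v y, y cnj u + v x)\<close>.\<close>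

definition hconj :: "complex \<times> complex \<Rightarrow> complex \<times> complex" where
  "hconj p = (cnj (fst p), - snd p)"

definition hmult :: "complex \<times> complex \<Rightarrow> complex \<times> complex \<Rightarrow> complex \<times> complex" where
  "hmult p q = (fst p * fst q - cnj (snd q) * snd p, snd p * cnj (fst q) + snd q * fst p)"

definition qi :: "complex \<times> complex" where "qi = (\<i>, 0)"

type_synonym oct = "(complex \<times> complex) \<times> (complex \<times> complex)"

definition oconj :: "oct \<Rightarrow> oct" where
  "oconj p = (hconj (fst p), - snd p)"

text \<open>Octonions: \<open>\<bbbH> \<times> \<bbbH>\<close> with the Cayley--Dickson product \<open>\<bullet>\<close> of the paper.\<close>
definition omult :: "oct \<Rightarrow> oct \<Rightarrow> oct" where
  "omult p q = (hmult (fst p) (fst q) - hmult (hconj (snd q)) (snd p),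
                hmult (snd p) (hconj (fst q)) + hmult (snd q) (fst p))"

definition oi :: oct where "oi = (qi, 0)"

definition R_mult :: "real \<Rightarrow> real \<Rightarrow> real" where "R_mult x y = x * y"
definition C_mult :: "complex \<Rightarrow> complex \<Rightarrow> complex" where "C_mult x y = x * y"
definition starC_mult :: "complex \<Rightarrow> complex \<Rightarrow> complex" where "starC_mult x y = cnj x * y"
definition H_mult :: "complex \<times> complex \<Rightarrow> complex \<times> complex \<Rightarrow> complex \<times> complex" where
  "H_mult x y = hmult x y"
definition starH_mult :: "complex \<times> complex \<Rightarrow> complex \<times> complex \<Rightarrow> complex \<times> complex" where
  "starH_mult x y = hmult (hconj x) y"
definition O_mult :: "oct \<Rightarrow> oct \<Rightarrow> oct" where "O_mult x y = omult x y"
definition starO_mult :: "oct \<Rightarrow> oct \<Rightarrow> oct" where "starO_mult x y = omult (oconj x) y"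

text \<open>\<open>*\<bbbH>(i,1)\<close>: \<open>x \<odot> y = cnj x i y\<close> (associative, so bracketing is irrelevant).\<close>
definition starHi1_mult :: "complex \<times> complex \<Rightarrow> complex \<times> complex \<Rightarrow> complex \<times> complex" where
  "starHi1_mult x y = hmult (hmult (hconj x) qi) y"

definition starOi1_mult :: "oct \<Rightarrow> oct \<Rightarrow> oct" where
  "starOi1_mult x y = omult (omult (oconj x) oi) y"

definition tildeO_mult :: "oct \<Rightarrow> oct \<Rightarrow> oct" where
  "tildeO_mult p q = omult (hconj (fst p), snd p) q"

definition tildeOi_mult :: "oct \<Rightarrow> oct \<Rightarrow> oct" where
  "tildeOi_mult p q =
     omult (hmult (hmult qi (hconj (fst p))) (hconj qi), hmult (hmult qi (snd p)) qi) q"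

end

theory Submission
  imports Defs
begin

text \<open>Expanding \<open>(x\<^sup>2, x\<^sup>2, x\<^sup>2) = 0\<close> at \<open>x = e + t y\<close> to first order in \<open>t\<close> gives \<open>(y e) e = y\<close>, so right
multiplication \<open>\<rho>\<close> by the left unit \<open>e\<close> is an isometric involution and \<open>x \<odot> y = (x e) y\<close> is an
absolute-valued product with two-sided unit \<open>e\<close>; the original product is \<open>\<rho> x \<odot> y\<close>.

For \<open>\<odot>\<close> the norm comes from an inner product, and Cayley--Dickson doubling shows that the algebra is
\<open>\<real>\<close>, \<open>\<complex>\<close>, the quaternions or the octonions. Let \<open>P\<close> and \<open>N\<close> be the spaces of imaginary elements on
which \<open>\<rho>\<close> is \<open>1\<close> and \<open>- 1\<close>. The identity for \<open>x = p + n\<close> forces \<open>P \<odot> N \<subseteq> P\<close>. If \<open>N = 0\<close> or \<open>P = 0\<close>, then \<open>\<rho>\<close>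
is the identity or the conjugation and the degree is at most \<open>2\<close>. Otherwise some element generates at
least three dimensions, and doubling along vectors chosen in \<open>P\<close> and \<open>N\<close> leaves three algebras:
the quaternions with \<open>dim N = 1\<close>, and the octonions with \<open>dim N = 1\<close> or with \<open>\<real> e + N\<close> a
quaternion subalgebra.\<close>

section \<open>Unital absolute-valued algebras are Euclidean\<close>

locale unital_absolute_valued =
  fixes mul :: "'a::real_normed_vector \<Rightarrow> 'a \<Rightarrow> 'a" (infixl "\<odot>" 70) and e :: 'a
  assumes bilinear_mul: "bilinear mul"
    and norm_mul: "norm (x \<odot> y) = norm x * norm y"
    and left_unit: "e \<odot> x = x"
    and right_unit: "x \<odot> e = x"
    and unit_nonzero: "e \<noteq> 0"
begin

lemmas mul_add_left = bilinear_ladd[OF bilinear_mul]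
  and mul_add_right = bilinear_radd[OF bilinear_mul]
  and mul_diff_left = bilinear_lsub[OF bilinear_mul]
  and mul_diff_right = bilinear_rsub[OF bilinear_mul]
  and mul_scaleR_left = bilinear_lmul[OF bilinear_mul]
  and mul_scaleR_right = bilinear_rmul[OF bilinear_mul]
  and mul_minus_left = bilinear_lneg[OF bilinear_mul]
  and mul_minus_right = bilinear_rneg[OF bilinear_mul]
  and mul_zero_left = bilinear_lzero[OF bilinear_mul]
  and mul_zero_right = bilinear_rzero[OF bilinear_mul]

lemmas mul_simps = mul_add_left mul_add_right mul_diff_left mul_diff_right mul_scaleR_left
  mul_scaleR_right mul_minus_left mul_minus_right mul_zero_left mul_zero_right left_unit right_unit

section \<open>Smoothness of the norm at the unit\<close>

lemma norm_unit: "norm e = 1"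
  using norm_mul[of e e] unit_nonzero by (simp add: left_unit)

text \<open>The derivative of the norm at \<open>e\<close>; it turns out to be the real-part functional.\<close>
definition re :: "'a \<Rightarrow> real" where
  "re x = (INF t\<in>{0<..}. (norm (e + t *\<^sub>R x) - 1) / t)"

lemma quotient_ge: "- norm x \<le> (norm (e + t *\<^sub>R x) - 1) / t" if "t > 0" for t :: real
proof -
  have "norm e - norm (t *\<^sub>R x) \<le> norm (e + t *\<^sub>R x)"
    using norm_diff_ineq by blast
  then have "- (t * norm x) \<le> norm (e + t *\<^sub>R x) - 1"
    using that by (simp add: norm_unit)
  then show ?thesis
    using that by (simp add: field_simps)
qed

lemma quotient_le: "(norm (e + t *\<^sub>R x) - 1) / t \<le> norm x" if "t > 0" for t :: real
proof -
  have "norm (e + t *\<^sub>R x) \<le> 1 + t * norm x"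
    using norm_triangle_ineq[of e "t *\<^sub>R x"] that by (simp add: norm_unit)
  then show ?thesis
    using that by (simp add: field_simps)
qed

lemma re_le: "re x \<le> (norm (e + t *\<^sub>R x) - 1) / t" if "t > 0"
  unfolding re_def
  by (rule cINF_lower) (use that quotient_ge in \<open>auto intro!: bdd_belowI2\<close>)

lemma re_greatest: "c \<le> re x" if "\<And>t. t > 0 \<Longrightarrow> c \<le> (norm (e + t *\<^sub>R x) - 1) / t"
  unfolding re_def by (rule cINF_greatest) (use that in auto)

text \<open>Convexity of the norm: for a suitable \<tau>, e + \<tau> (x + y) is a convex combination
  of e + t x and e + s y, so its quotient is at most the sum of theirs.\<close>

lemma re_subadd: "re (x + y) \<le> re x + re y"
proof -
  have *: "re (x + y) \<le> (norm (e + t *\<^sub>R x) - 1) / t + (norm (e + s *\<^sub>R y) - 1) / s"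
    if t: "t > 0" and s: "s > 0" for t s :: real
  proof -
    define \<tau> where "\<tau> = t * s / (t + s)"
    have pos: "\<tau> > 0"
      using t s by (simp add: \<tau>_def)
    have ts: "\<tau> / t = s / (t + s)" "\<tau> / s = t / (t + s)"
      using t s by (simp_all add: \<tau>_def)
    have one: "\<tau> / t + \<tau> / s = 1"
      unfolding ts using t s by (simp add: add_divide_distrib[symmetric] add.commute)
    have "(\<tau> / t) *\<^sub>R (e + t *\<^sub>R x) + (\<tau> / s) *\<^sub>R (e + s *\<^sub>R y)
      = (\<tau> / t + \<tau> / s) *\<^sub>R e + \<tau> *\<^sub>R (x + y)"
      using t s by (simp add: algebra_simps)
    then have "norm (e + \<tau> *\<^sub>R (x + y)) \<le> norm ((\<tau> / t) *\<^sub>R (e + t *\<^sub>R x)) + norm ((\<tau> / s) *\<^sub>R (e + s *\<^sub>R y))"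
      by (metis norm_triangle_ineq one scaleR_one)
    also have "\<dots> = \<tau> / t * norm (e + t *\<^sub>R x) + \<tau> / s * norm (e + s *\<^sub>R y)"
      using pos t s by simp
    finally have "norm (e + \<tau> *\<^sub>R (x + y)) - 1
      \<le> \<tau> / t * (norm (e + t *\<^sub>R x) - 1) + \<tau> / s * (norm (e + s *\<^sub>R y) - 1)"
      using one by (simp add: algebra_simps)
    then have "(norm (e + \<tau> *\<^sub>R (x + y)) - 1) / \<tau>
      \<le> (norm (e + t *\<^sub>R x) - 1) / t + (norm (e + s *\<^sub>R y) - 1) / s"
      using pos by (simp add: pos_divide_le_eq distrib_left mult.commute[of _ \<tau>])
    with re_le[OF pos] show ?thesis
      by (rule order_trans)
  qed
  have "re (x + y) - (norm (e + t *\<^sub>R x) - 1) / t \<le> re y" if "t > 0" for t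
    by (rule re_greatest) (use *[OF that] in \<open>simp add: diff_le_eq add.commute\<close>)
  then have "re (x + y) - re y \<le> (norm (e + t *\<^sub>R x) - 1) / t" if "t > 0" for t
    using that by (simp add: algebra_simps)
  from re_greatest[OF this] show ?thesis
    by simp
qed

lemma re_scaleR_pos: "re (c *\<^sub>R x) = c * re x" if "c > 0"
proof (rule antisym)
  have le: "re (c *\<^sub>R x) \<le> c * re x" if "c > 0" for c x
  proof -
    have "re (c *\<^sub>R x) / c \<le> re x"
    proof (rule re_greatest)
      fix t :: real assume "t > 0"
      then have "re (c *\<^sub>R x) \<le> (norm (e + (t / c) *\<^sub>R c *\<^sub>R x) - 1) / (t / c)"
        using that by (intro re_le) simp
      then show "re (c *\<^sub>R x) / c \<le> (norm (e + t *\<^sub>R x) - 1) / t"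
        using that \<open>t > 0\<close> by (simp add: field_simps)
    qed
    then show ?thesis
      using that by (simp add: field_simps)
  qed
  show "re (c *\<^sub>R x) \<le> c * re x"
    using le[OF that] .
  have "re ((1 / c) *\<^sub>R (c *\<^sub>R x)) \<le> (1 / c) * re (c *\<^sub>R x)"
    using that by (intro le) simp
  then show "c * re x \<le> re (c *\<^sub>R x)"
    using that by (simp add: field_simps)
qed

text \<open>The norm is smooth at \<open>e\<close> because \<open>(e + t x) (e - t x) = e - t\<^sup>2 x\<^sup>2\<close> differs from \<open>e\<close>
  only in second order.\<close>
lemma re_minus: "re (- x) = - re x"
proof -
  have zero: "re 0 = 0"
    using re_scaleR_pos[of 2 0] by simp
  have "re x + re (- x) \<le> 2 * t * (norm x)\<^sup>2" if t: "t > 0" for t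
  proof -
    define a where "a = (norm (e + t *\<^sub>R x) - 1) / t"
    define b where "b = (norm (e + t *\<^sub>R (- x)) - 1) / t"
    have ab: "re x \<le> a" "re (- x) \<le> b"
      unfolding a_def b_def by (rule re_le[OF t])+
    have "\<bar>a\<bar> \<le> norm x" "\<bar>b\<bar> \<le> norm x"
      unfolding a_def b_def abs_le_iff
      using quotient_ge[OF t, of x] quotient_le[OF t, of x]
        quotient_ge[OF t, of "- x"] quotient_le[OF t, of "- x"] by simp_all
    then have "\<bar>a * b\<bar> \<le> norm x * norm x"
      by (simp add: abs_mult mult_mono)
    then have absab: "- (norm x)\<^sup>2 \<le> a * b"
      by (simp add: power2_eq_square)
    have "(1 + t * a) * (1 + t * b) = norm (e + t *\<^sub>R x) * norm (e + t *\<^sub>R (- x))"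
      using t by (simp add: a_def b_def)
    also have "\<dots> = norm (e - (t * t) *\<^sub>R (x \<odot> x))"
      by (simp flip: norm_mul add: mul_simps algebra_simps)
    also have "\<dots> \<le> 1 + t * t * (norm x)\<^sup>2"
      using norm_triangle_ineq4[of e "(t * t) *\<^sub>R (x \<odot> x)"] t
      by (simp add: norm_unit norm_mul power2_eq_square)
    finally have "t * (a + b + t * (a * b)) \<le> t * (t * (norm x)\<^sup>2)"
      by (simp add: algebra_simps)
    then have "a + b + t * (a * b) \<le> t * (norm x)\<^sup>2"
      using t by simp
    moreover have "- (t * (norm x)\<^sup>2) \<le> t * (a * b)"
      using mult_left_mono[OF absab, of t] t by simp
    ultimately show ?thesis
      using ab by linarith
  qed
  then have *: "re x + re (- x) \<le> t * (2 * (norm x)\<^sup>2)" if "t > 0" for t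
    using that by (simp add: mult_ac)
  have "re x + re (- x) \<le> 0"
  proof (rule tendsto_lowerbound)
    show "((\<lambda>t. t * (2 * (norm x)\<^sup>2)) \<longlongrightarrow> 0) (at_right 0)"
      by (auto intro!: tendsto_eq_intros)
    show "\<forall>\<^sub>F t in at_right 0. re x + re (- x) \<le> t * (2 * (norm x)\<^sup>2)"
      using * by (auto simp: eventually_at_right_field intro: exI[of _ 1])
  qed simp
  moreover have "0 \<le> re x + re (- x)"
    using re_subadd[of x "- x"] zero by simp
  ultimately show ?thesis
    by simp
qed

lemma re_add: "re (x + y) = re x + re y"
  using re_subadd[of x y] re_subadd[of "- x" "- y"] re_minus[of x] re_minus[of y] re_minus[of "x + y"]
  by simp

lemma re_scaleR: "re (c *\<^sub>R x) = c * re x"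
proof (cases c "0::real" rule: linorder_cases)
  case less
  then show ?thesis
    using re_scaleR_pos[of "- c" x] by (simp add: re_minus)
next
  case equal
  then show ?thesis
    using re_add[of 0 0] by simp
qed (rule re_scaleR_pos)

lemma linear_re: "linear re"
  by (rule linearI) (simp_all add: re_add re_scaleR)

lemmas re_diff = linear_diff[OF linear_re]
  and re_0 = linear_0[OF linear_re]

lemma re_unit: "re e = 1"
proof (rule antisym)
  have q: "(norm (e + t *\<^sub>R e) - 1) / t = 1" if "t > 0" for t
  proof -
    have "e + t *\<^sub>R e = (1 + t) *\<^sub>R e"
      by (simp add: algebra_simps)
    then show ?thesis
      using that by (simp add: norm_unit)
  qed
  show "re e \<le> 1"
    using re_le[of 1 e] q[of 1] by simp
  show "1 \<le> re e"
    by (rule re_greatest) (simp add: q)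
qed

section \<open>The norm on planes through the unit\<close>

lemma norm_ge_1: "1 \<le> norm (e + t *\<^sub>R x)" if "re x = 0"
proof (cases t "0::real" rule: linorder_cases)
  case less
  then show ?thesis
    using re_le[of "- t" "- x"] that by (simp add: re_minus divide_le_0_iff)
next
  case greater
  then show ?thesis
    using re_le[of t x] that by (simp add: zero_le_divide_iff)
qed (simp add: norm_unit)

text \<open>With \<open>u \<phi> = cos \<phi> e + sin \<phi> y\<close>, the product \<open>u \<phi> \<odot> u (\<theta> - \<phi>)\<close> equals \<open>A + c B\<close> with
  \<open>c = cos (2 \<phi> - \<theta>)\<close> and \<open>A\<close>, \<open>B\<close> depending on \<open>\<theta>\<close> only. So \<open>\<parallel>u \<phi>\<parallel> \<parallel>u (\<theta> - \<phi>)\<parallel>\<close> is a convex function of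
  \<open>c \<in> [-1, 1]\<close> bounded by \<open>1\<close>, and its value at \<open>c = cos \<theta>\<close> is \<open>\<parallel>u \<theta>\<parallel>\<close>. If \<open>\<parallel>u \<theta>\<parallel>\<close> is close to \<open>1\<close>, then so is
  the function everywhere.\<close>
lemma norm_circle:
  assumes le: "\<And>a b. (norm (a *\<^sub>R e + b *\<^sub>R y))\<^sup>2 \<le> a\<^sup>2 + b\<^sup>2"
    and near: "\<And>\<epsilon>. \<epsilon> > 0 \<Longrightarrow> \<exists>t. t \<noteq> 0 \<and> 1 + (1 - \<epsilon>) * t\<^sup>2 \<le> (norm (e + t *\<^sub>R y))\<^sup>2"
  shows "(norm (a *\<^sub>R e + b *\<^sub>R y))\<^sup>2 = a\<^sup>2 + b\<^sup>2"
proof -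
  define u where "u \<phi> = cos \<phi> *\<^sub>R e + sin \<phi> *\<^sub>R y" for \<phi>
  have u_le: "norm (u \<phi>) \<le> 1" for \<phi>
    using le[of "cos \<phi>" "sin \<phi>"] by (simp add: u_def abs_square_le_1)
  have u_ge: "1 - 4 * \<epsilon> \<le> norm (u \<phi>)" if \<epsilon>: "\<epsilon> > 0" for \<phi> \<epsilon>
  proof -
    obtain t where t: "t \<noteq> 0" "1 + (1 - \<epsilon>) * t\<^sup>2 \<le> (norm (e + t *\<^sub>R y))\<^sup>2"
      using near[OF \<epsilon>] by blast
    \<comment> \<open>This angle puts e + t y on the ray through \<open>u \<theta>\<close>.\<close>
    define \<theta> where "\<theta> = arctan t"
    have k0: "cos \<theta> > 0"
      unfolding \<theta>_def using cos_arctan_not_zero[of t] by (simp add: cos_arctan add_pos_nonneg)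
    have sin: "sin \<theta> = t * cos \<theta>"
      using tan_arctan[of t] k0 by (simp add: \<theta>_def tan_def field_simps)
    have k1: "cos \<theta> < 1"
    proof (rule ccontr)
      assume "\<not> cos \<theta> < 1"
      then have "cos \<theta> = 1"
        using cos_le_one[of \<theta>] by linarith
      then show False
        using sin_cos_squared_add[of \<theta>] sin t(1) by simp
    qed
    define A where "A = (cos \<theta> / 2) *\<^sub>R (e - y \<odot> y) + sin \<theta> *\<^sub>R y"
    define B where "B = (1 / 2) *\<^sub>R (e + y \<odot> y)"
    define N where "N c = norm (A + c *\<^sub>R B)" for c
    have prod: "u \<alpha> \<odot> u (\<theta> - \<alpha>) = A + cos (2 * \<alpha> - \<theta>) *\<^sub>R B" for \<alpha>
    proof -
      have 1: "cos \<alpha> * cos (\<theta> - \<alpha>) = cos \<theta> / 2 + cos (2 * \<alpha> - \<theta>) / 2"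
        by (simp add: cos_times_cos field_simps)
      have 2: "sin \<alpha> * sin (\<theta> - \<alpha>) = cos (2 * \<alpha> - \<theta>) / 2 - cos \<theta> / 2"
        by (simp add: sin_times_sin field_simps)
      have 3: "cos \<alpha> * sin (\<theta> - \<alpha>) + sin \<alpha> * cos (\<theta> - \<alpha>) = sin \<theta>"
        using sin_add[of \<alpha> "\<theta> - \<alpha>"] by (simp add: add.commute mult.commute)
      have "u \<alpha> \<odot> u (\<theta> - \<alpha>) = (cos \<alpha> * cos (\<theta> - \<alpha>)) *\<^sub>R e
        + (cos \<alpha> * sin (\<theta> - \<alpha>) + sin \<alpha> * cos (\<theta> - \<alpha>)) *\<^sub>R y
        + (sin \<alpha> * sin (\<theta> - \<alpha>)) *\<^sub>R (y \<odot> y)"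
        by (simp add: u_def mul_simps algebra_simps)
      also have "\<dots> = A + cos (2 * \<alpha> - \<theta>) *\<^sub>R B"
        unfolding 1 2 3 A_def B_def by (simp add: algebra_simps)
      finally show ?thesis .
    qed
    have N_cos: "N (cos (2 * \<alpha> - \<theta>)) = norm (u \<alpha>) * norm (u (\<theta> - \<alpha>))" for \<alpha>
      unfolding N_def prod[symmetric] norm_mul ..
    have N_le: "N (cos (2 * \<alpha> - \<theta>)) \<le> 1" for \<alpha>
      unfolding N_cos using u_le by (simp add: mult_le_one)
    have N1: "norm (A + B) \<le> 1"
      using N_le[of "\<theta> / 2"] by (simp add: N_def)
    have N2: "norm (A - B) \<le> 1"
      using N_le[of "\<theta> / 2 + pi / 2"] by (simp add: N_def)
    define k where "k = cos \<theta>"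
    define c where "c = cos (2 * \<phi> - \<theta>)"
    have c: "-1 \<le> c" "c \<le> 1"
      by (simp_all add: c_def)
    define r where "r = norm (u \<theta>)"
    have r: "r = N k"
      using N_cos[of 0] by (simp add: r_def k_def u_def norm_unit)
    have r1: "r \<le> 1"
      using u_le by (simp add: r_def)
    \<comment> \<open>Three-point convexity: k lies between c and one of the endpoints 1 and - 1,
      where \<open>N\<close> is at most 1.\<close>
    have "(1 - k) * (1 - N c) \<le> 2 * (1 - r)"
    proof (cases "c \<le> k")
      case True
      have "(1 - c) *\<^sub>R (A + k *\<^sub>R B) = (1 - k) *\<^sub>R (A + c *\<^sub>R B) + (k - c) *\<^sub>R (A + B)"
        by (simp add: algebra_simps)
      then have "norm ((1 - c) *\<^sub>R (A + k *\<^sub>R B))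
        \<le> norm ((1 - k) *\<^sub>R (A + c *\<^sub>R B)) + norm ((k - c) *\<^sub>R (A + B))"
        by (metis norm_triangle_ineq)
      then have "(1 - c) * r \<le> (1 - k) * N c + (k - c) * norm (A + B)"
        using c True k1 by (simp add: r N_def k_def)
      also have "\<dots> \<le> (1 - k) * N c + (k - c)"
        using N1 True mult_left_mono[of "norm (A + B)" 1 "k - c"] by simp
      finally have "(1 - k) * (1 - N c) \<le> (1 - c) * (1 - r)"
        by (simp add: algebra_simps)
      also have "\<dots> \<le> 2 * (1 - r)"
        using c r1 by (intro mult_right_mono) auto
      finally show ?thesis .
    next
      case False
      have "(1 + c) *\<^sub>R (A + k *\<^sub>R B) = (1 + k) *\<^sub>R (A + c *\<^sub>R B) + (c - k) *\<^sub>R (A - B)"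
        by (simp add: algebra_simps)
      then have "norm ((1 + c) *\<^sub>R (A + k *\<^sub>R B))
        \<le> norm ((1 + k) *\<^sub>R (A + c *\<^sub>R B)) + norm ((c - k) *\<^sub>R (A - B))"
        by (metis norm_triangle_ineq)
      then have "(1 + c) * r \<le> (1 + k) * N c + (c - k) * norm (A - B)"
        using c False k0 by (simp add: r N_def k_def)
      also have "\<dots> \<le> (1 + k) * N c + (c - k)"
        using N2 False mult_left_mono[of "norm (A - B)" 1 "c - k"] by simp
      finally have "(1 + k) * (1 - N c) \<le> (1 + c) * (1 - r)"
        by (simp add: algebra_simps)
      also have "\<dots> \<le> 2 * (1 - r)"
        using c r1 by (intro mult_right_mono) auto
      finally have "(1 + k) * (1 - N c) \<le> 2 * (1 - r)" .
      moreover have "(1 - k) * (1 - N c) \<le> (1 + k) * (1 - N c)"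
        using N_le[of \<phi>] k0 by (intro mult_right_mono) (auto simp: c_def k_def)
      ultimately show ?thesis
        by simp
    qed
    also have "1 - r \<le> 1 - r\<^sup>2"
      using r1 mult_left_mono[of r 1 r] by (simp add: r_def power2_eq_square)
    \<comment> \<open>The allowed deficit scales with t^2, hence with 1 - k^2. Its factor 1 - k
      cancels the one on the left, so the final bound does not depend on t.\<close>
    also have "1 - r\<^sup>2 \<le> \<epsilon> * (1 - k\<^sup>2)"
    proof -
      have "u \<theta> = k *\<^sub>R (e + t *\<^sub>R y)"
        by (simp add: u_def k_def sin algebra_simps)
      then have "r\<^sup>2 = k\<^sup>2 * (norm (e + t *\<^sub>R y))\<^sup>2"
        by (simp add: r_def power_mult_distrib)
      moreover have "k\<^sup>2 * (1 + (1 - \<epsilon>) * t\<^sup>2) \<le> k\<^sup>2 * (norm (e + t *\<^sub>R y))\<^sup>2"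
        using t(2) by (intro mult_left_mono) auto
      moreover have "k\<^sup>2 * t\<^sup>2 = 1 - k\<^sup>2"
        using sin_squared_eq[of \<theta>] by (simp add: sin k_def power_mult_distrib mult.commute)
      ultimately show ?thesis
        by (simp add: algebra_simps)
    qed
    also have "2 * (\<epsilon> * (1 - k\<^sup>2)) = (1 - k) * (2 * \<epsilon> * (1 + k))"
      by (simp add: power2_eq_square algebra_simps)
    finally have "1 - N c \<le> 2 * \<epsilon> * (1 + k)"
      using k1 by (simp add: k_def)
    also have "\<dots> \<le> 4 * \<epsilon>"
      using \<epsilon> k1 mult_left_mono[of "1 + k" 2 "2 * \<epsilon>"] by (simp add: k_def)
    finally have "1 - N c \<le> 4 * \<epsilon>" .
    moreover have "N c \<le> norm (u \<phi>)"
      unfolding c_def N_cos using u_le by (simp add: mult_left_le)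
    ultimately show ?thesis
      by simp
  qed
  have u1: "norm (u \<phi>) = 1" for \<phi>
  proof (rule antisym[OF u_le field_le_epsilon])
    fix \<epsilon> :: real assume "\<epsilon> > 0"
    then show "1 \<le> norm (u \<phi>) + \<epsilon>"
      using u_ge[of "\<epsilon> / 4" \<phi>] by simp
  qed
  obtain r \<phi> where "a = r * cos \<phi>" "b = r * sin \<phi>"
    using polar_Ex[of a b] by blast
  then have *: "a *\<^sub>R e + b *\<^sub>R y = r *\<^sub>R u \<phi>" and "a\<^sup>2 + b\<^sup>2 = r\<^sup>2 * ((cos \<phi>)\<^sup>2 + (sin \<phi>)\<^sup>2)"
    by (simp_all add: u_def scaleR_add_right power_mult_distrib distrib_left
        del: sin_cos_squared_add sin_cos_squared_add2)
  then show ?thesis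
    unfolding * by (simp add: u1)
qed

text \<open>The constant \<open>\<kappa>\<close> is the least one with \<open>\<parallel>a e + b x\<parallel>\<^sup>2 \<le> a\<^sup>2 + \<kappa> b\<^sup>2\<close>; minimality supplies the near-equality
  needed for the circle argument, also when the supremum is only approached as \<open>t\<close> tends to \<open>0\<close>.\<close>
lemma norm_plane:
  assumes x: "re x = 0"
  shows "(norm (a *\<^sub>R e + b *\<^sub>R x))\<^sup>2 = a\<^sup>2 + b\<^sup>2 * (norm x)\<^sup>2"
proof (cases "x = 0")
  case False
  define q where "q t = ((norm (e + t *\<^sub>R x))\<^sup>2 - 1) / t\<^sup>2" for t :: real
  define M where "M = 3 * (norm x)\<^sup>2"
  have q_le: "q t \<le> M" if "t \<noteq> 0" for t
  proof -
    define s where "s = \<bar>t\<bar> * norm x"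
    have s: "s \<ge> 0"
      by (simp add: s_def)
    have "(norm (e + t *\<^sub>R x))\<^sup>2 \<le> 1 + 3 * s\<^sup>2"
    \<comment> \<open>For small s the factor norm (e - t x) \<ge> 1 is inserted, since (e + t x) (e
      - t x) has no first-order term. For large s the triangle inequality suffices.\<close>
    proof (cases "s \<le> 1")
      case True
      have "norm (e + t *\<^sub>R x) * 1 \<le> norm (e + t *\<^sub>R x) * norm (e + (- t) *\<^sub>R x)"
        using norm_ge_1[OF x, of "- t"] by (intro mult_left_mono) auto
      also have "\<dots> = norm (e - (t * t) *\<^sub>R (x \<odot> x))"
        by (simp flip: norm_mul add: mul_simps algebra_simps)
      also have "\<dots> \<le> 1 + s\<^sup>2"
        using norm_triangle_ineq4[of e "(t * t) *\<^sub>R (x \<odot> x)"]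
        by (simp add: norm_unit norm_mul power2_eq_square s_def abs_mult mult_ac)
      finally have "(norm (e + t *\<^sub>R x))\<^sup>2 \<le> (1 + s\<^sup>2)\<^sup>2"
        by (simp add: power_mono)
      also have "\<dots> = 1 + s\<^sup>2 * (2 + s\<^sup>2)"
        by (simp add: power2_eq_square algebra_simps)
      also have "\<dots> \<le> 1 + s\<^sup>2 * 3"
        using True s by (intro add_left_mono mult_left_mono) (auto simp: power_le_one)
      finally show ?thesis by simp
    next
      case False
      have "norm (e + t *\<^sub>R x) \<le> 1 + s"
        using norm_triangle_ineq[of e "t *\<^sub>R x"] by (simp add: norm_unit s_def)
      then have "(norm (e + t *\<^sub>R x))\<^sup>2 \<le> (1 + s)\<^sup>2"
        by (simp add: power_mono)
      also have "\<dots> = 1 + s * 2 + s * s"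
        by (simp add: power2_eq_square algebra_simps)
      also have "\<dots> \<le> 1 + s * (2 * s) + s * s"
        using False s by (intro add_left_mono add_right_mono mult_left_mono) auto
      finally show ?thesis by (simp add: power2_eq_square)
    qed
    then show ?thesis
      using that by (simp add: q_def M_def s_def divide_le_eq power_mult_distrib algebra_simps)
  qed
  define \<kappa> where "\<kappa> = (SUP t\<in>-{0}. q t)"
  have ne: "-{0::real} \<noteq> {}"
    by (auto intro: exI[of _ 1])
  have bdd: "bdd_above (q ` (-{0}))"
    using q_le by (auto intro!: bdd_aboveI2)
  have q_\<kappa>: "q t \<le> \<kappa>" if "t \<noteq> 0" for t
    unfolding \<kappa>_def by (rule cSUP_upper) (use that bdd in auto)
  have le1: "(norm (e + t *\<^sub>R x))\<^sup>2 \<le> 1 + \<kappa> * t\<^sup>2" for t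
    using q_\<kappa>[of t] by (cases "t = 0") (auto simp: q_def divide_le_eq norm_unit)
  have le2: "(norm (a *\<^sub>R e + b *\<^sub>R x))\<^sup>2 \<le> a\<^sup>2 + \<kappa> * b\<^sup>2" if "a \<noteq> 0" for a b
  proof -
    have *: "a *\<^sub>R e + b *\<^sub>R x = a *\<^sub>R (e + (b / a) *\<^sub>R x)"
      using that by (simp add: algebra_simps)
    have "(norm (a *\<^sub>R e + b *\<^sub>R x))\<^sup>2 = a\<^sup>2 * (norm (e + (b / a) *\<^sub>R x))\<^sup>2"
      unfolding * by (simp add: power_mult_distrib)
    also have "\<dots> \<le> a\<^sup>2 * (1 + \<kappa> * (b / a)\<^sup>2)"
      by (intro mult_left_mono le1) simp
    also have "\<dots> = a\<^sup>2 + \<kappa> * b\<^sup>2"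
      using that by (simp add: distrib_left power_divide)
    finally show ?thesis .
  qed
  have le3: "(norm (a *\<^sub>R e + b *\<^sub>R x))\<^sup>2 \<le> a\<^sup>2 + \<kappa> * b\<^sup>2" for a b
  \<comment> \<open>At a = 0 one cannot divide by a; the bound extends by continuity.\<close>
  proof (cases "a = 0")
    case True
    have "(norm (0 *\<^sub>R e + b *\<^sub>R x))\<^sup>2 \<le> 0\<^sup>2 + \<kappa> * b\<^sup>2"
    proof (rule tendsto_le)
      show "((\<lambda>a. (norm (a *\<^sub>R e + b *\<^sub>R x))\<^sup>2) \<longlongrightarrow> (norm (0 *\<^sub>R e + b *\<^sub>R x))\<^sup>2) (at (0::real))"
        by (intro tendsto_intros)
      show "((\<lambda>a. a\<^sup>2 + \<kappa> * b\<^sup>2) \<longlongrightarrow> 0\<^sup>2 + \<kappa> * b\<^sup>2) (at (0::real))"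
        by (intro tendsto_intros)
      show "\<forall>\<^sub>F a in at 0. (norm (a *\<^sub>R e + b *\<^sub>R x))\<^sup>2 \<le> a\<^sup>2 + \<kappa> * b\<^sup>2"
        using le2 by (auto simp: eventually_at intro: exI[of _ 1])
    qed simp
    then show ?thesis
      using True by simp
  qed (rule le2)
  have "(norm x)\<^sup>2 \<le> \<kappa>"
    using le3[of 0 1] by simp
  then have \<kappa>: "\<kappa> > 0"
    using False by (smt (verit) zero_less_norm_iff zero_less_power)
  \<comment> \<open>Rescaling turns \<kappa> into 1, as \<open>norm_circle\<close> requires; only
    its conclusion shows that \<kappa> is the squared norm of x.\<close>
  define y where "y = (1 / sqrt \<kappa>) *\<^sub>R x"
  have xy: "x = sqrt \<kappa> *\<^sub>R y"
    using \<kappa> by (simp add: y_def)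
  have y: "(norm (a *\<^sub>R e + b *\<^sub>R y))\<^sup>2 = a\<^sup>2 + b\<^sup>2" for a b
  proof (rule norm_circle)
    show "(norm (a *\<^sub>R e + b *\<^sub>R y))\<^sup>2 \<le> a\<^sup>2 + b\<^sup>2" for a b
      using le3[of a "b / sqrt \<kappa>"] \<kappa> by (simp add: y_def power_divide)
    fix \<epsilon> :: real assume \<epsilon>: "\<epsilon> > 0"
    have "\<kappa> * (1 - \<epsilon>) < (SUP t\<in>-{0}. q t)"
      using \<epsilon> \<kappa> mult_pos_pos[of \<kappa> \<epsilon>] unfolding \<kappa>_def[symmetric] by (simp add: algebra_simps)
    then obtain t where t: "t \<noteq> 0" "\<kappa> * (1 - \<epsilon>) < q t"
      using less_cSUP_iff[OF ne bdd] by auto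
    then have "1 + (1 - \<epsilon>) * (sqrt \<kappa> * t)\<^sup>2 \<le> (norm (e + (sqrt \<kappa> * t) *\<^sub>R y))\<^sup>2"
      using \<kappa> by (simp add: q_def less_divide_eq y_def power_mult_distrib algebra_simps)
    then show "\<exists>t. t \<noteq> 0 \<and> 1 + (1 - \<epsilon>) * t\<^sup>2 \<le> (norm (e + t *\<^sub>R y))\<^sup>2"
      using t(1) \<kappa> by (intro exI[of _ "sqrt \<kappa> * t"]) simp
  qed
  have "norm y = 1"
    using y[of 0 1] norm_ge_zero[of y] by (auto simp: power2_eq_1_iff simp del: norm_ge_zero)
  then have nx: "(norm x)\<^sup>2 = \<kappa>"
    using \<kappa> by (simp add: xy)
  have "(norm (a *\<^sub>R e + (b * sqrt \<kappa>) *\<^sub>R y))\<^sup>2 = a\<^sup>2 + b\<^sup>2 * \<kappa>"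
    using y[of a "b * sqrt \<kappa>"] \<kappa> by (simp add: power_mult_distrib)
  then show ?thesis
    unfolding nx by (simp add: xy mult.commute)
qed (simp add: norm_unit power2_abs)

text \<open>A unit vector \<open>y\<close> with \<open>re y = 0\<close> satisfies \<open>\<parallel>y\<^sup>2 - e\<parallel> = \<parallel>y - e\<parallel> \<parallel>y + e\<parallel> = 2 = \<parallel>y\<^sup>2\<parallel> + \<parallel>e\<parallel>\<close>; in the Euclidean
  plane spanned by \<open>e\<close> and \<open>y\<^sup>2\<close> this is the equality case of the triangle inequality.\<close>
lemma imaginary_square:
  assumes x: "re x = 0"
  shows "x \<odot> x = - (norm x)\<^sup>2 *\<^sub>R e"
proof -
  have unit: "y \<odot> y = - e" if y: "re y = 0" "norm y = 1" for y
  proof -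
    define d where "d = re (y \<odot> y)"
    define h where "h = y \<odot> y - d *\<^sub>R e"
    have h: "re h = 0"
      by (simp add: h_def d_def re_diff re_scaleR re_unit)
    have "norm (y \<odot> y - e) = norm (y + e) * norm (y - e)"
      by (simp flip: norm_mul add: mul_simps)
    moreover have "(norm (y + e))\<^sup>2 = 2" "(norm (y - e))\<^sup>2 = 2"
      using norm_plane[OF y(1), of 1 1] norm_plane[OF y(1), of "- 1" 1] y(2) by (simp_all add: add.commute)
    ultimately have "(norm (y \<odot> y - e))\<^sup>2 = 4"
      by (simp add: power_mult_distrib)
    moreover have "y \<odot> y - e = (d - 1) *\<^sub>R e + 1 *\<^sub>R h"
      by (simp add: h_def algebra_simps)
    ultimately have 1: "(d - 1)\<^sup>2 + (norm h)\<^sup>2 = 4"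
      using norm_plane[OF h, of "d - 1" 1] by simp
    have "y \<odot> y = d *\<^sub>R e + 1 *\<^sub>R h"
      by (simp add: h_def)
    then have 2: "d\<^sup>2 + (norm h)\<^sup>2 = 1"
      using norm_plane[OF h, of d 1] norm_mul[of y y] y(2) by simp
    have d: "d = - 1"
      using 1 2 by (simp add: power2_eq_square algebra_simps)
    then have "h = 0"
      using 2 by simp
    then show ?thesis
      using d by (simp add: h_def eq_neg_iff_add_eq_0)
  qed
  show ?thesis
  proof (cases "x = 0")
    case False
    define y where "y = (1 / norm x) *\<^sub>R x"
    have "y \<odot> y = - e"
      using False x by (intro unit) (simp_all add: y_def re_scaleR)
    moreover have "x = norm x *\<^sub>R y"
      using False by (simp add: y_def)
    then have "x \<odot> x = (norm x)\<^sup>2 *\<^sub>R (y \<odot> y)"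
      by (metis mul_scaleR_left mul_scaleR_right power2_eq_square scaleR_scaleR)
    ultimately show ?thesis
      by simp
  qed (simp add: mul_simps)
qed

section \<open>The inner product and the composition law\<close>

text \<open>On imaginary elements the form is \<open>- re (x y + y x) / 2\<close>, bilinear by construction, and
  \<open>x\<^sup>2 = - \<parallel>x\<parallel>\<^sup>2 e\<close> identifies its quadratic form with the squared norm.\<close>
definition ip :: "'a \<Rightarrow> 'a \<Rightarrow> real" where
  "ip x y = re x * re y
     - re ((x - re x *\<^sub>R e) \<odot> (y - re y *\<^sub>R e) + (y - re y *\<^sub>R e) \<odot> (x - re x *\<^sub>R e)) / 2"

lemma ip_commute: "ip x y = ip y x"
  by (simp add: ip_def add.commute mult.commute)

lemma ip_add_left: "ip (x + y) z = ip x z + ip y z"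
  by (simp add: ip_def mul_simps re_add re_diff re_scaleR algebra_simps add_divide_distrib diff_divide_distrib)

lemma ip_scaleR_left: "ip (c *\<^sub>R x) z = c * ip x z"
  by (simp add: ip_def mul_simps re_add re_diff re_scaleR algebra_simps add_divide_distrib diff_divide_distrib)

lemma ip_add_right: "ip z (x + y) = ip z x + ip z y"
  by (simp add: ip_commute[of z] ip_add_left)

lemma ip_scaleR_right: "ip z (c *\<^sub>R x) = c * ip z x"
  by (simp add: ip_commute[of z] ip_scaleR_left)

lemma ip_minus_left: "ip (- x) z = - ip x z"
  using ip_scaleR_left[of "- 1" x z] by simp

lemma ip_minus_right: "ip z (- x) = - ip z x"
  by (simp add: ip_commute[of z] ip_minus_left)

lemma ip_diff_left: "ip (x - y) z = ip x z - ip y z"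
  using ip_add_left[of x "- y" z] by (simp add: ip_minus_left)

lemma ip_diff_right: "ip z (x - y) = ip z x - ip z y"
  by (simp add: ip_commute[of z] ip_diff_left)

lemma ip_zero_left: "ip 0 z = 0"
  using ip_scaleR_left[of 0 0 z] by simp

lemma ip_zero_right: "ip z 0 = 0"
  by (simp add: ip_commute[of z] ip_zero_left)

lemmas ip_simps = ip_add_left ip_add_right ip_scaleR_left ip_scaleR_right ip_minus_left
  ip_minus_right ip_diff_left ip_diff_right ip_zero_left ip_zero_right

lemma ip_self: "ip x x = (norm x)\<^sup>2"
proof -
  define h where "h = x - re x *\<^sub>R e"
  have h: "re h = 0"
    by (simp add: h_def re_diff re_scaleR re_unit)
  have "x = re x *\<^sub>R e + 1 *\<^sub>R h"
    by (simp add: h_def)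
  then have "(norm x)\<^sup>2 = (re x)\<^sup>2 + (norm h)\<^sup>2"
    using norm_plane[OF h, of "re x" 1] by simp
  moreover have "ip x x = (re x)\<^sup>2 + (norm h)\<^sup>2"
    by (simp add: ip_def imaginary_square[OF h] re_add re_scaleR re_minus re_diff re_unit power2_eq_square
        flip: h_def)
  ultimately show ?thesis
    by simp
qed

lemma ip_unit_left: "ip e x = re x"
  by (simp add: ip_def re_unit mul_simps re_0)

lemma ip_polar: "ip x y = ((norm (x + y))\<^sup>2 - (norm x)\<^sup>2 - (norm y)\<^sup>2) / 2"
  by (simp add: ip_self[symmetric] ip_simps ip_commute[of y x])

lemma ip_eqI: "x = y" if "\<And>z. ip x z = ip y z"
proof -
  have "ip (x - y) (x - y) = 0"
    unfolding ip_diff_left[of x y "x - y"] that by simp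
  then show ?thesis
    by (simp add: ip_self)
qed

lemma ip_mul_same_right: "ip (x \<odot> y) (z \<odot> y) = ip x z * (norm y)\<^sup>2"
  by (simp add: ip_polar norm_mul power_mult_distrib algebra_simps flip: mul_add_left)

text \<open>Linearises \<open>ip_mul_same_right\<close> in y. The adjoint rules come from it by
  inserting e, the conjugation laws by moving factors across \<open>ip\<close>.\<close>

lemma ip_exchange: "ip (x \<odot> y) (z \<odot> w) + ip (x \<odot> w) (z \<odot> y) = 2 * ip x z * ip y w"
  using ip_mul_same_right[of x "y + w" z] ip_mul_same_right[of x y z] ip_mul_same_right[of x w z]
  by (simp add: mul_simps ip_simps ip_self[symmetric] ip_commute[of w y] algebra_simps)

subsection \<open>Composition identities and Cayley--Dickson doubling\<close>

definition conj :: "'a \<Rightarrow> 'a" where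
  "conj x = (2 * re x) *\<^sub>R e - x"

lemma conj_add: "conj (x + y) = conj x + conj y"
  by (simp add: conj_def re_add algebra_simps)

lemma conj_conj: "conj (conj x) = x"
  by (simp add: conj_def re_diff re_scaleR re_unit)

lemma conj_imaginary: "re x = 0 \<Longrightarrow> conj x = - x"
  by (simp add: conj_def)

lemma ip_mul_left_adjoint: "ip (x \<odot> y) z = ip y (conj x \<odot> z)"
  using ip_exchange[of x y e z]
  by (simp add: conj_def mul_simps ip_simps ip_commute[of x e] ip_unit_left ip_commute[of y])

lemma ip_mul_right_adjoint: "ip (y \<odot> x) z = ip y (z \<odot> conj x)"
  using ip_exchange[of y x z e]
  by (simp add: conj_def mul_simps ip_simps ip_commute[of x e] ip_unit_left algebra_simps)

lemma conj_mul_exchange: "conj x \<odot> (y \<odot> z) + conj y \<odot> (x \<odot> z) = (2 * ip x y) *\<^sub>R z"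
proof (rule ip_eqI)
  fix w
  show "ip (conj x \<odot> (y \<odot> z) + conj y \<odot> (x \<odot> z)) w = ip ((2 * ip x y) *\<^sub>R z) w"
    using ip_exchange[of y z x w]
    by (simp only: ip_simps ip_mul_left_adjoint[of "conj _"] conj_conj)
       (simp add: ip_commute[of "y \<odot> w"] ip_commute[of y x])
qed

lemma mul_conj_exchange: "(z \<odot> y) \<odot> conj x + (z \<odot> x) \<odot> conj y = (2 * ip x y) *\<^sub>R z"
proof (rule ip_eqI)
  fix w
  show "ip ((z \<odot> y) \<odot> conj x + (z \<odot> x) \<odot> conj y) w = ip ((2 * ip x y) *\<^sub>R z) w"
    using ip_exchange[of z y w x]
    by (simp add: ip_simps ip_mul_right_adjoint[of _ "conj _"] conj_conj ip_commute[of y x])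
qed

lemma conj_mul: "conj (x \<odot> y) = conj y \<odot> conj x"
proof (rule ip_eqI)
  fix z
  have "ip (conj (x \<odot> y)) z = ip e ((x \<odot> y) \<odot> z)"
    using ip_mul_left_adjoint[of "conj (x \<odot> y)" e z] by (simp add: right_unit conj_conj)
  also have "\<dots> = ip (x \<odot> y) (conj z)"
    using ip_mul_right_adjoint[of "x \<odot> y" z e] by (simp add: left_unit ip_commute)
  also have "\<dots> = ip z (conj y \<odot> conj x)"
    by (metis ip_mul_left_adjoint ip_mul_right_adjoint conj_conj ip_commute)
  finally show "ip (conj (x \<odot> y)) z = ip (conj y \<odot> conj x) z"
    by (simp add: ip_commute)
qed

lemma imaginary_mul_self_right: "(y \<odot> x) \<odot> x = - (norm x)\<^sup>2 *\<^sub>R y" if "re x = 0"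
proof -
  have "2 *\<^sub>R ((y \<odot> x) \<odot> x) = - ((y \<odot> x) \<odot> conj x + (y \<odot> x) \<odot> conj x)"
    by (simp add: conj_imaginary[OF that] mul_simps scaleR_2)
  also have "\<dots> = 2 *\<^sub>R (- (norm x)\<^sup>2 *\<^sub>R y)"
    unfolding mul_conj_exchange ip_self by simp
  finally have "2 *\<^sub>R ((y \<odot> x) \<odot> x) = 2 *\<^sub>R (- (norm x)\<^sup>2 *\<^sub>R y)" .
  then show ?thesis
    by (simp only: scaleR_cancel_left) simp
qed

lemma imaginary_anticommute: "y \<odot> x = - (x \<odot> y)" if "re x = 0" "re y = 0" "ip x y = 0"
  using conj_mul_exchange[of x y e] that
  by (simp add: conj_imaginary mul_simps eq_neg_iff_add_eq_0 add.commute)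

lemma re_mul_orthogonal: "re (x \<odot> y) = 0" if "re y = 0" "ip x y = 0"
  using ip_mul_right_adjoint[of x y e] that
  by (simp add: conj_imaginary mul_simps ip_simps ip_unit_left ip_commute[of _ e])

section \<open>Cayley-Dickson doubling of a proper subalgebra\<close>

definition subalgebra :: "'a set \<Rightarrow> bool" where
  "subalgebra B \<longleftrightarrow> subspace B \<and> e \<in> B \<and> (\<forall>x\<in>B. \<forall>y\<in>B. x \<odot> y \<in> B)"

lemma subalgebra_conj: "conj x \<in> B" if "subalgebra B" "x \<in> B"
  using that by (simp add: subalgebra_def conj_def subspace_diff subspace_scale)

context
  fixes B l
  assumes B: "subalgebra B" and l: "norm l = 1" and orth: "\<And>x. x \<in> B \<Longrightarrow> ip l x = 0"
begin

lemma re_new_unit: "re l = 0"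
  using orth[of e] B by (simp add: subalgebra_def ip_commute[of l] ip_unit_left)

lemma re_mul_new_unit: "re (x \<odot> l) = 0" if "x \<in> B"
  using re_mul_orthogonal[OF re_new_unit, of x] orth[OF that] by (simp add: ip_commute)

text \<open>Both l and x l are imaginary, so the conjugate of x l is - (x l) directly and - (l conj
  x) by \<open>conj_mul\<close>.\<close>

lemma new_unit_commute: "x \<odot> l = l \<odot> conj x" if "x \<in> B"
  using conj_mul[of x l] conj_imaginary[OF re_mul_new_unit[OF that]] conj_imaginary[OF re_new_unit]
  by (simp add: mul_simps)

lemma double_mul_right: "x \<odot> (y \<odot> l) = (y \<odot> x) \<odot> l" if "x \<in> B" "y \<in> B"
proof -
  have "x \<odot> (l \<odot> conj y) - l \<odot> (conj x \<odot> conj y) = 0"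
    using conj_mul_exchange[of "conj x" l "conj y"] orth[OF subalgebra_conj[OF B that(1)]]
    by (simp add: conj_conj conj_imaginary[OF re_new_unit] mul_simps ip_commute[of _ l])
  moreover have "y \<odot> x \<in> B"
    using that B by (simp add: subalgebra_def)
  ultimately show ?thesis
    using that by (simp add: new_unit_commute conj_mul)
qed

lemma double_mul_left: "(x \<odot> l) \<odot> y = (x \<odot> conj y) \<odot> l" if "x \<in> B" "y \<in> B"
  using mul_conj_exchange[of x l "conj y"] orth[OF subalgebra_conj[OF B that(2)]]
  by (simp add: conj_conj conj_imaginary[OF re_new_unit] mul_simps ip_commute[of _ l])

lemma ip_new_unit: "ip x (y \<odot> l) = 0" if "x \<in> B" "y \<in> B"
proof -
  have "ip x (y \<odot> l) = ip l (conj y \<odot> x)"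
    by (simp add: ip_commute[of x] ip_mul_left_adjoint)
  then show ?thesis
    using orth[of "conj y \<odot> x"] that B subalgebra_conj[OF B that(2)] by (simp add: subalgebra_def)
qed

lemma double_mul_both: "(x \<odot> l) \<odot> (y \<odot> l) = - (conj y \<odot> x)" if "x \<in> B" "y \<in> B"
proof -
  have "(x \<odot> l) \<odot> (y \<odot> l) + conj y \<odot> (- (x \<odot> l) \<odot> l) = 0"
    using conj_mul_exchange[of "- (x \<odot> l)" y l] ip_new_unit[OF that(2,1)]
      conj_imaginary[of "- (x \<odot> l)"] re_mul_new_unit[OF that(1)]
    by (simp add: ip_commute[of _ y] ip_minus_right re_minus)
  then show ?thesis
    using imaginary_mul_self_right[OF re_new_unit, of x] l
    by (simp add: mul_simps eq_neg_iff_add_eq_0)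
qed

lemma double_mul:
  assumes "x \<in> B" "y \<in> B" "u \<in> B" "v \<in> B"
  shows "(x + y \<odot> l) \<odot> (u + v \<odot> l)
    = (x \<odot> u - conj v \<odot> y) + (y \<odot> conj u + v \<odot> x) \<odot> l"
  using assms by (simp add: mul_simps double_mul_left double_mul_right double_mul_both)

text \<open>Multiplicativity of the norm beyond B restricts B itself: the exchange law for products
  with l makes the associator d orthogonal to itself.\<close>

lemma proper_subalgebra_assoc: "(x \<odot> y) \<odot> z = x \<odot> (y \<odot> z)" if xyz: "x \<in> B" "y \<in> B" "z \<in> B"
proof -
  have cl: "a \<odot> b \<in> B" if "a \<in> B" "b \<in> B" for a b
    using that B by (simp add: subalgebra_def)
  define d where "d = (x \<odot> y) \<odot> z - x \<odot> (y \<odot> z)"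
  have d: "d \<in> B"
    unfolding d_def using xyz B cl by (intro subspace_diff) (auto simp: subalgebra_def)
  have "ip (y \<odot> z) ((d \<odot> l) \<odot> (x \<odot> l)) + ip (y \<odot> (x \<odot> l)) ((d \<odot> l) \<odot> z) = 0"
    using ip_exchange[of y z "d \<odot> l" "x \<odot> l"] ip_new_unit[OF xyz(2) d] by simp
  then have "ip (x \<odot> y) (d \<odot> conj z) = ip (y \<odot> z) (conj x \<odot> d)"
    using xyz d cl subalgebra_conj[OF B]
    by (simp add: double_mul_left double_mul_right double_mul_both ip_mul_same_right l ip_minus_right)
  then have "ip ((x \<odot> y) \<odot> z) d = ip (x \<odot> (y \<odot> z)) d"
    by (simp add: ip_mul_right_adjoint[of "x \<odot> y"] ip_mul_left_adjoint[of x])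
  then have "ip d d = 0"
    by (simp add: d_def ip_diff_left)
  then show ?thesis
    by (simp add: ip_self d_def)
qed

end

section \<open>Model embeddings and the Hurwitz classification\<close>

text \<open>The models share no symbol for a unit, so only \<open>e \<in> range f\<close> is
  recorded. Compatibility with c lets the doubling be repeated.\<close>

definition embedding :: "('b::euclidean_space \<Rightarrow> 'b \<Rightarrow> 'b) \<Rightarrow> ('b \<Rightarrow> 'b) \<Rightarrow> ('b \<Rightarrow> 'a) \<Rightarrow> bool" where
  "embedding p c f \<longleftrightarrow> linear f \<and> (\<forall>x y. ip (f x) (f y) = x \<bullet> y)
     \<and> (\<forall>x y. f (p x y) = f x \<odot> f y) \<and> (\<forall>x. f (c x) = conj (f x)) \<and> e \<in> range f"

lemma embedding_norm: "embedding p c f \<Longrightarrow> norm (f x) = norm x"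
  using ip_self[of "f x"] by (simp add: embedding_def dot_square_norm)

lemma embedding_inj: "embedding p c f \<Longrightarrow> inj f"
  using embedding_norm[of p c f] by (auto simp: linear_injective_0 embedding_def) (metis norm_eq_zero)

lemma embedding_subalgebra: "subalgebra (range f)" if "embedding p c f"
  using that unfolding embedding_def subalgebra_def
  by (auto simp: linear_subspace_image) (metis rangeI)

text \<open>Orthogonal projection onto the range exists because the model is finite-dimensional,
  although the algebra is not yet known to be.\<close>

lemma obtain_orthogonal:
  assumes f: "embedding p c f" and "\<not> surj f"
  obtains l where "norm l = 1" "\<And>x. ip l (f x) = 0"
proof -
  obtain z where z: "z \<notin> range f"
    using assms(2) by auto
  define w where "w = z - f (\<Sum>b\<in>Basis. ip z (f b) *\<^sub>R b)"
  have f': "linear f" "ip (f x) (f y) = x \<bullet> y" for x y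
    using f by (auto simp: embedding_def)
  define \<phi> where "\<phi> x = ip z (f x)" for x
  have lin: "linear \<phi>"
    by (rule linearI) (simp_all add: \<phi>_def linear_add[OF f'(1)] linear_scale[OF f'(1)] ip_simps)
  have zf: "ip z (f x) = (\<Sum>b\<in>Basis. ip z (f b) *\<^sub>R b) \<bullet> x" for x
  proof -
    have "\<phi> x = \<phi> (\<Sum>b\<in>Basis. (x \<bullet> b) *\<^sub>R b)"
      by (simp only: euclidean_representation)
    also have "\<dots> = (\<Sum>b\<in>Basis. (x \<bullet> b) * \<phi> b)"
      by (simp add: linear_sum[OF lin] linear_scale[OF lin])
    also have "\<dots> = (\<Sum>b\<in>Basis. \<phi> b *\<^sub>R b) \<bullet> x"
      unfolding inner_sum_left by (intro sum.cong refl) (simp add: inner_commute)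
    finally show ?thesis
      by (simp only: \<phi>_def)
  qed
  have w: "ip w (f x) = 0" for x
    by (simp add: w_def ip_diff_left f' zf[of x])
  have "w \<noteq> 0"
    using z by (auto simp: w_def)
  then show ?thesis
    using w by (intro that[of "(1 / norm w) *\<^sub>R w"]) (auto simp: ip_scaleR_left)
qed

lemma real_embedding: "embedding R_mult id (\<lambda>r. r *\<^sub>R e)"
  unfolding embedding_def
  by (auto simp: R_mult_def conj_def mul_simps ip_simps ip_unit_left re_unit re_scaleR
      image_iff algebra_simps intro: linearI exI[of _ 1])
     (simp flip: scaleR_2 add: mult.commute)

lemma complex_embedding:
  assumes l: "norm l = 1" "re l = 0"
  shows "embedding C_mult cnj (\<lambda>z. Re z *\<^sub>R e + Im z *\<^sub>R l)"
proof -
  have [simp]: "l \<odot> l = - e" "ip e l = 0" "ip l e = 0" "ip l l = 1" "ip e e = 1"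
    using l imaginary_square[OF l(2)]
    by (simp_all add: ip_self ip_unit_left ip_commute[of l e] norm_unit)
  have "e = Re 1 *\<^sub>R e + Im 1 *\<^sub>R l"
    by simp
  then have "e \<in> range (\<lambda>z. Re z *\<^sub>R e + Im z *\<^sub>R l)"
    by (rule range_eqI)
  then show ?thesis
    unfolding embedding_def
    by (auto simp: C_mult_def conj_def mul_simps ip_simps l re_unit re_add re_scaleR inner_complex_def
        algebra_simps intro!: linearI)
       (simp flip: scaleR_2 add: mult.commute)
qed

text \<open>This is \<open>double_mul\<close> in coordinates; it leads from the complex numbers to
  the quaternions and on to the octonions.\<close>

lemma double_embedding:
  assumes f: "embedding p c f" and l: "norm l = 1" "\<And>x. ip l (f x) = 0"
  shows "embedding (\<lambda>x y. (p (fst x) (fst y) - p (c (snd y)) (snd x),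
      p (snd x) (c (fst y)) + p (snd y) (fst x))) (\<lambda>x. (c (fst x), - snd x))
    (\<lambda>x. f (fst x) + f (snd x) \<odot> l)"
proof -
  have f': "linear f" "ip (f x) (f y) = x \<bullet> y" "f (p x y) = f x \<odot> f y" "f (c x) = conj (f x)" for x y
    using f by (auto simp: embedding_def)
  note lin = linear_add[OF f'(1)] linear_diff[OF f'(1)] linear_neg[OF f'(1)] linear_scale[OF f'(1)]
  have sub: "subalgebra (range f)" and orth: "x \<in> range f \<Longrightarrow> ip l x = 0" for x
    using embedding_subalgebra[OF f] l by auto
  note D = double_mul[OF sub l(1) orth] ip_new_unit[OF sub l(1) orth] re_mul_new_unit[OF sub l(1) orth]
  obtain u where u: "e = f u"
    using f by (auto simp: embedding_def)
  have "e = f (fst (u, 0)) + f (snd (u, 0)) \<odot> l"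
    by (simp add: u linear_0[OF f'(1)] mul_simps)
  then have unit: "e \<in> range (\<lambda>x. f (fst x) + f (snd x) \<odot> l)"
    by (rule range_eqI)
  have linear: "linear (\<lambda>x. f (fst x) + f (snd x) \<odot> l)"
    by (rule linearI) (simp_all add: lin mul_simps algebra_simps)
  have isom: "ip (f (fst x) + f (snd x) \<odot> l) (f (fst y) + f (snd y) \<odot> l) = x \<bullet> y" for x y
    by (simp add: ip_simps D(2) ip_commute[of "f _ \<odot> l" "f _"] ip_mul_same_right l f' inner_prod_def)
  have conj: "f (c (fst x)) + f (- snd x) \<odot> l = conj (f (fst x) + f (snd x) \<odot> l)" for x
    by (simp add: lin mul_simps conj_add f' conj_imaginary D(3))
  have hom: "f (p (fst x) (fst y) - p (c (snd y)) (snd x)) + f (p (snd x) (c (fst y)) + p (snd y) (fst x)) \<odot> l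
      = (f (fst x) + f (snd x) \<odot> l) \<odot> (f (fst y) + f (snd y) \<odot> l)" for x y
    by (subst D(1)) (simp_all add: lin f')
  show ?thesis
    unfolding embedding_def fst_conv snd_conv
    by (intro conjI allI linear isom hom conj unit)
qed

lemma quaternion_embedding:
  assumes "embedding C_mult cnj f" "norm l = 1" "\<And>x. ip l (f x) = 0"
  shows "embedding hmult hconj (\<lambda>x. f (fst x) + f (snd x) \<odot> l)"
  using double_embedding[OF assms] by (simp add: hmult_def[abs_def] hconj_def[abs_def] C_mult_def)

lemma octonion_embedding:
  assumes "embedding hmult hconj f" "norm l = 1" "\<And>x. ip l (f x) = 0"
  shows "embedding omult oconj (\<lambda>x. f (fst x) + f (snd x) \<odot> l)"
  using double_embedding[OF assms] by (simp add: omult_def[abs_def] oconj_def[abs_def])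

text \<open>A further orthogonal unit vector would make the octonions associative.\<close>

lemma octonion_embedding_surj: "surj f" if f: "embedding omult oconj f"
proof (rule ccontr)
  assume "\<not> surj f"
  then obtain l where l: "norm l = 1" "\<And>x. ip l (f x) = 0"
    using obtain_orthogonal[OF f] by blast
  \<comment> \<open>The quaternion units i and j and the unit of the last doubling do not
    associate.\<close>
  define a b c :: oct where "a = oi" and "b = ((0, 1), 0)" and "c = (0, (1, 0))"
  have "(f a \<odot> f b) \<odot> f c = f a \<odot> (f b \<odot> f c)"
    using l by (intro proper_subalgebra_assoc[OF embedding_subalgebra[OF f]]) auto
  moreover have "f (omult x y) = f x \<odot> f y" for x y
    using f unfolding embedding_def by blast
  ultimately have "f (omult (omult a b) c) = f (omult a (omult b c))"
    by simp
  then have "omult (omult a b) c = omult a (omult b c)"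
    using embedding_inj[OF f] by (simp add: inj_eq)
  then show False
    by (simp add: a_def b_def c_def oi_def qi_def omult_def hmult_def hconj_def zero_prod_def)
qed

text \<open>Orthogonal unit vectors are adjoined until the embedding is onto, at the latest for the
  octonions.\<close>

lemma hurwitz:
  "(\<exists>f. embedding R_mult id f \<and> surj f) \<or> (\<exists>f. embedding C_mult cnj f \<and> surj f)
    \<or> (\<exists>f. embedding hmult hconj f \<and> surj f) \<or> (\<exists>f. embedding omult oconj f \<and> surj f)"
proof (cases "surj (\<lambda>r. r *\<^sub>R e)")
  case True
  then show ?thesis
    using real_embedding by blast
next
  case False
  from obtain_orthogonal[OF real_embedding this]
  obtain l1 where l1: "norm l1 = 1" "ip l1 (r *\<^sub>R e) = 0" for r
    by blast
  have "re l1 = 0"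
    using l1(2)[of 1] by (simp add: ip_commute[of l1] ip_unit_left)
  from complex_embedding[OF l1(1) this] obtain f1 where f1: "embedding C_mult cnj f1"
    by blast
  show ?thesis
  proof (cases "surj f1")
    case False
    from obtain_orthogonal[OF f1 this] obtain l2 where l2: "norm l2 = 1" "ip l2 (f1 x) = 0" for x
      by blast
    from quaternion_embedding[OF f1 l2] obtain f2 where f2: "embedding hmult hconj f2"
      by blast
    show ?thesis
    proof (cases "surj f2")
      case False
      from obtain_orthogonal[OF f2 this] obtain l3 where l3: "norm l3 = 1" "ip l3 (f2 x) = 0" for x
        by blast
      from octonion_embedding[OF f2 l3] show ?thesis
        using octonion_embedding_surj by blast
    qed (use f2 in blast)
  qed (use f1 in blast)
qed
end

section \<open>The twisting involution\<close>

text \<open>The maps built here run from the model to the algebra; the isomorphism is the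
  inverse.\<close>

lemma alg_isomorphicI:
  assumes "linear f" "bij f" "\<And>x y. f (m2 x y) = m1 (f x) (f y)"
  shows "alg_isomorphic m1 m2"
proof -
  have f: "f (inv f x) = x" for x
    using assms(2) by (simp add: bij_is_surj surj_f_inv_f)
  have "inv f (m1 x y) = m2 (inv f x) (inv f y)" for x y
    using assms(2,3) f by (metis bij_inv_eq_iff)
  moreover have "linear (inv f)"
  proof (rule linearI)
    show "inv f (x + y) = inv f x + inv f y" for x y
      by (rule sym) (simp add: bij_inv_eq_iff[OF assms(2)] linear_add[OF assms(1)] f)
    show "inv f (c *\<^sub>R x) = c *\<^sub>R inv f x" for c x
      by (rule sym) (simp add: bij_inv_eq_iff[OF assms(2)] linear_scale[OF assms(1)] f)
  qed
  ultimately show ?thesis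
    unfolding alg_isomorphic_def using assms(2) bij_imp_bij_inv by blast
qed

section \<open>Generated subalgebras and degree\<close>

lemma subspace_subalg_gen: "subspace (subalg_gen m S)"
  unfolding subalg_gen_def by (rule subspace_Inter) auto

lemma subalg_gen_base: "x \<in> S \<Longrightarrow> x \<in> subalg_gen m S"
  by (auto simp: subalg_gen_def)

lemma subalg_gen_closed: "a \<in> subalg_gen m S \<Longrightarrow> b \<in> subalg_gen m S \<Longrightarrow> m a b \<in> subalg_gen m S"
  by (auto simp: subalg_gen_def)

lemma subalg_gen_minimal:
  assumes "subspace B" "S \<subseteq> B" "\<And>a b. a \<in> B \<Longrightarrow> b \<in> B \<Longrightarrow> m a b \<in> B"
  shows "subalg_gen m S \<subseteq> B"
  using assms by (auto simp: subalg_gen_def)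

lemma degree_le: "degree m \<le> n" if "\<And>x. dim (subalg_gen m {x}) \<le> n"
  unfolding degree_def using that by (intro Least_le) blast

text \<open>\<open>LEAST\<close> has the desired property only if some bound exists, hence the
  premise.\<close>

lemma dim_le_degree: "dim (subalg_gen m {x}) \<le> degree m" if "\<And>x. dim (subalg_gen m {x}) \<le> n"
  unfolding degree_def using LeastI[of "\<lambda>n. \<forall>x. dim (subalg_gen m {x}) \<le> n" n] that by blast

text \<open>In \<open>starHi1_mult\<close> and \<open>starOi1_mult\<close> the left unit is \<open>i\<close>. Left multiplication by \<open>- i\<close> moves it
  to \<open>1\<close> and turns the first argument into its image under the reflection \<open>x \<mapsto> - i cnj x i\<close>, which
  negates \<open>i\<close> and fixes its orthogonal complement.\<close>

definition hrot :: "complex \<times> complex \<Rightarrow> complex \<times> complex" where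
  "hrot x = (- \<i> * fst x, - \<i> * snd x)"

lemma linear_hrot: "linear hrot"
  by (rule linearI) (simp_all add: hrot_def algebra_simps scaleR_conv_of_real)

lemma bij_hrot: "bij hrot"
  by (rule o_bij[of "\<lambda>x. (\<i> * fst x, \<i> * snd x)"]) (simp_all add: fun_eq_iff hrot_def)

lemma hrot_starHi1_mult:
  "hrot (starHi1_mult x y) = hmult (cnj (fst (hrot x)), snd (hrot x)) (hrot y)"
  by (simp add: hrot_def starHi1_mult_def hmult_def hconj_def qi_def algebra_simps)

text \<open>Left multiplication by - \<open>oi\<close>: in the second half \<open>omult\<close> puts
  the left factor on the right, which flips the sign of the last coordinate.\<close>

definition orot :: "oct \<Rightarrow> oct" where
  "orot x = ((- \<i> * fst (fst x), - \<i> * snd (fst x)), (- \<i> * fst (snd x), \<i> * snd (snd x)))"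

lemma linear_orot: "linear orot"
  by (rule linearI) (simp_all add: orot_def algebra_simps scaleR_conv_of_real)

lemma bij_orot: "bij orot"
  by (rule o_bij[of "\<lambda>x. ((\<i> * fst (fst x), \<i> * snd (fst x)), (\<i> * fst (snd x), - \<i> * snd (snd x)))"])
    (simp_all add: fun_eq_iff orot_def)

lemma orot_starOi1_mult:
  "orot (starOi1_mult x y)
    = omult ((cnj (fst (fst (orot x))), snd (fst (orot x))), snd (orot x)) (orot y)"
  by (simp add: orot_def starOi1_mult_def omult_def oconj_def oi_def hmult_def hconj_def qi_def)
    (simp add: algebra_simps)

section \<open>Fixed and skew vectors of the twist\<close>

text \<open>\<open>square_assoc\<close> is (x^2, x^2, x^2) = 0 for the product \<open>tw\<close>.
  Naming the square s lets it apply to any element known to be a square.\<close>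

locale twisted_absolute_valued = unital_absolute_valued mul e
  for mul :: "'a::real_normed_vector \<Rightarrow> 'a \<Rightarrow> 'a" (infixl "\<odot>" 70) and e +
  fixes \<rho> :: "'a \<Rightarrow> 'a"
  assumes linear_\<rho>: "linear \<rho>"
    and norm_\<rho>: "norm (\<rho> x) = norm x"
    and \<rho>_\<rho>: "\<rho> (\<rho> x) = x"
    and \<rho>_unit: "\<rho> e = e"
    and square_assoc: "s = \<rho> x \<odot> x \<Longrightarrow> \<rho> (\<rho> s \<odot> s) \<odot> s = \<rho> s \<odot> (\<rho> s \<odot> s)"
begin

abbreviation tw :: "'a \<Rightarrow> 'a \<Rightarrow> 'a" where
  "tw x y \<equiv> \<rho> x \<odot> y"

lemmas \<rho>_simps = linear_add[OF linear_\<rho>] linear_diff[OF linear_\<rho>] linear_neg[OF linear_\<rho>]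
  linear_scale[OF linear_\<rho>] linear_0[OF linear_\<rho>] \<rho>_\<rho> \<rho>_unit

lemma ip_\<rho>: "ip (\<rho> x) (\<rho> y) = ip x y"
  by (simp add: ip_polar norm_\<rho> flip: linear_add[OF linear_\<rho>])

lemma ip_\<rho>_left: "ip (\<rho> x) y = ip x (\<rho> y)"
  using ip_\<rho>[of x "\<rho> y"] by (simp add: \<rho>_\<rho>)

lemma re_\<rho>: "re (\<rho> x) = re x"
  using ip_\<rho>[of e x] by (simp add: \<rho>_unit ip_unit_left)

lemma re_skew: "re x = 0" if "\<rho> x = - x"
  using re_\<rho>[of x] that by (simp add: re_minus)

lemma ip_fixed_skew: "ip x y = 0" if "\<rho> x = x" "\<rho> y = - y"
  using ip_\<rho>[of x y] that by (simp add: ip_minus_right)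

lemma skew_mul_fixed: "y \<odot> x = - (x \<odot> y)" if "\<rho> x = x" "re x = 0" "\<rho> y = - y"
  by (rule imaginary_anticommute[OF that(2) re_skew[OF that(3)] ip_fixed_skew[OF that(1,3)]])

text \<open>\<rho> turns x + y into x - y, and anticommutation doubles the mixed term of (x - y) (x
  + y).\<close>

lemma square_fixed_add_skew:
  assumes "\<rho> x = x" "re x = 0" "\<rho> y = - y"
  shows "tw (x + y) (x + y) = ((norm y)\<^sup>2 - (norm x)\<^sup>2) *\<^sub>R e + 2 *\<^sub>R (x \<odot> y)"
  using assms
  by (simp add: \<rho>_simps mul_simps skew_mul_fixed[OF assms] imaginary_square re_skew scaleR_2 algebra_simps)

text \<open>The squares of \<open>x + y\<close>, \<open>2 x + y / 2\<close> and \<open>x / 2 + 2 y\<close> involve the same product \<open>x y\<close> but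
  three different multiples of \<open>e\<close>, which isolates the leading coefficient of the identity.\<close>
lemma \<rho>_fixed_mul_skew_unit:
  assumes x: "\<rho> x = x" "re x = 0" "norm x = 1" and y: "\<rho> y = - y" "norm y = 1"
  shows "\<rho> (x \<odot> y) = x \<odot> y"
proof -
  define q where "q = 2 *\<^sub>R (x \<odot> y)"
  have s: "\<exists>x. a *\<^sub>R e + q = tw x x" if a: "a \<in> {0, 15/4, -15/4}" for a
  proof -
    \<comment> \<open>The values t = 1, 2 and 1/2 give e the coefficients 0, 15/4 and -
      15/4.\<close>
    have *: "(t\<^sup>2 - (1 / t)\<^sup>2) *\<^sub>R e + q = tw ((1 / t) *\<^sub>R x + t *\<^sub>R y) ((1 / t) *\<^sub>R x + t *\<^sub>R y)" if "t > 0" for t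
      using square_fixed_add_skew[of "(1 / t) *\<^sub>R x" "t *\<^sub>R y"] x y that
      by (simp add: \<rho>_simps re_scaleR q_def mul_simps)
    have "\<exists>x. 0 *\<^sub>R e + q = tw x x"
      using *[of 1] by (intro exI[of _ "x + y"]) simp
    moreover have "\<exists>x. (15/4) *\<^sub>R e + q = tw x x"
      using *[of 2] by (intro exI[of _ "(1/2) *\<^sub>R x + 2 *\<^sub>R y"]) (simp add: power2_eq_square)
    moreover have "\<exists>x. (-15/4) *\<^sub>R e + q = tw x x"
      using *[of "1/2"] by (intro exI[of _ "2 *\<^sub>R x + (1/2) *\<^sub>R y"]) (simp add: power2_eq_square)
    ultimately show ?thesis
      using a by blast
  qed
  \<comment> \<open>Coefficients of a^2, a and 1 in the identity for a e + q; the cubic terms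
    cancel. Adding the identities at opposite a removes \<open>c1\<close>.\<close>
  define c2 where "c2 = q - \<rho> q"
  define c1 where "c1 = (q + \<rho> q) \<odot> q + \<rho> (\<rho> q \<odot> q) - (\<rho> q \<odot> q) - \<rho> q \<odot> (q + \<rho> q)"
  define c0 where "c0 = \<rho> (\<rho> q \<odot> q) \<odot> q - \<rho> q \<odot> (\<rho> q \<odot> q)"
  have eq: "a\<^sup>2 *\<^sub>R c2 + a *\<^sub>R c1 + c0 = 0" if "a \<in> {0, 15/4, -15/4}" for a
  proof -
    obtain x where x: "a *\<^sub>R e + q = tw x x"
      using s[OF \<open>a \<in> _\<close>] by blast
    have "\<rho> (\<rho> (a *\<^sub>R e + q) \<odot> (a *\<^sub>R e + q)) \<odot> (a *\<^sub>R e + q)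
      - \<rho> (a *\<^sub>R e + q) \<odot> (\<rho> (a *\<^sub>R e + q) \<odot> (a *\<^sub>R e + q)) = 0"
      using square_assoc[OF x] by simp
    then show ?thesis
      by (simp add: c0_def c1_def c2_def \<rho>_simps mul_simps algebra_simps power2_eq_square)
  qed
  have "c0 = 0"
    using eq[of 0] by simp
  moreover have "((15/4)\<^sup>2 *\<^sub>R c2 + (15/4) *\<^sub>R c1 + c0) + ((-15/4)\<^sup>2 *\<^sub>R c2 + (-15/4) *\<^sub>R c1 + c0) = 0"
    unfolding eq[of "15/4", simplified] using eq[of "-15/4"] by simp
  ultimately have "c2 = 0"
    by (simp flip: scaleR_left.add)
  then show ?thesis
    by (simp add: c2_def q_def \<rho>_simps)
qed

lemma \<rho>_fixed_mul_skew: "\<rho> (x \<odot> y) = x \<odot> y" if "\<rho> x = x" "re x = 0" "\<rho> y = - y"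
proof (cases "x = 0 \<or> y = 0")
  case False
  have "\<rho> ((1 / norm x) *\<^sub>R x \<odot> (1 / norm y) *\<^sub>R y) = (1 / norm x) *\<^sub>R x \<odot> (1 / norm y) *\<^sub>R y"
    using that False by (intro \<rho>_fixed_mul_skew_unit) (simp_all add: \<rho>_simps re_scaleR)
  then show ?thesis
    using False by (simp add: mul_simps \<rho>_simps)
qed (auto simp: mul_simps \<rho>_simps)

lemma \<rho>_skew_mul_fixed: "\<rho> (y \<odot> x) = y \<odot> x" if "\<rho> x = x" "re x = 0" "\<rho> y = - y"
  using \<rho>_fixed_mul_skew[OF that] by (simp add: skew_mul_fixed[OF that] \<rho>_simps)

text \<open>Twice the fixed part of x y is p. As p x is fixed and y is skew, the adjoint rule makes
  p orthogonal to x y, hence to itself.\<close>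

lemma \<rho>_skew_mul_skew:
  assumes x: "\<rho> x = - x" and y: "\<rho> y = - y" and xy: "ip x y = 0"
  shows "\<rho> (x \<odot> y) = - (x \<odot> y)"
proof -
  define p where "p = x \<odot> y + \<rho> (x \<odot> y)"
  have p: "\<rho> p = p" "re p = 0"
    using re_mul_orthogonal[OF re_skew[OF y] xy] by (simp_all add: p_def \<rho>_simps re_add re_\<rho> add.commute)
  have "ip (x \<odot> y) p = ip y (conj x \<odot> p)"
    by (rule ip_mul_left_adjoint)
  also have "\<dots> = ip (p \<odot> x) y"
    by (simp add: conj_imaginary re_skew x mul_simps skew_mul_fixed[OF p x] ip_commute)
  also have "\<dots> = 0"
    by (intro ip_fixed_skew \<rho>_fixed_mul_skew p x y)
  finally have "ip (x \<odot> y) p = 0" .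
  moreover have "ip p z = ip (x \<odot> y) z + ip (x \<odot> y) (\<rho> z)" for z
    by (simp add: p_def ip_add_left ip_\<rho>_left)
  ultimately have "ip p p = 0"
    by (simp add: p)
  then show ?thesis
    by (simp add: ip_self p_def eq_neg_iff_add_eq_0 add.commute)
qed

section \<open>Identification with the models; the two pure cases\<close>

text \<open>Here \<sigma> is \<rho> in model coordinates, and k moves the left unit of the target
  algebra to the unit of the model where they differ.\<close>

lemma tw_isomorphic:
  assumes f: "embedding p c f" "surj f" "\<And>x. \<rho> (f x) = f (\<sigma> x)"
    and k: "linear k" "bij k" "\<And>x y. k (q x y) = p (\<sigma> (k x)) (k y)"
  shows "alg_isomorphic tw q"
proof (rule alg_isomorphicI)
  show "linear (f \<circ> k)"
    using f(1) k(1) by (intro linear_compose) (auto simp: embedding_def)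
  show "bij (f \<circ> k)"
    using k(2) f(2) embedding_inj[OF f(1)] by (simp add: bij_comp bijI)
  show "(f \<circ> k) (q x y) = \<rho> ((f \<circ> k) x) \<odot> (f \<circ> k) y" for x y
    using f(1) by (simp add: k(3) f(3) embedding_def)
qed

lemmas tw_isomorphic_id = tw_isomorphic[OF _ _ _ linear_id bij_id, unfolded id_apply]

lemma finite_dimensional_twisted: "finite_dimensional TYPE('a)"
proof -
  have *: "?thesis" if "linear f" "surj f" for f :: "'b::euclidean_space \<Rightarrow> 'a"
    unfolding finite_dimensional_def using that
    by (intro exI[of _ "f ` Basis"]) (simp add: linear_span_image span_Basis)
  show ?thesis
    using hurwitz unfolding embedding_def by (auto intro: *)
qed

text \<open>The span of e and the imaginary part h of x is closed under \<odot>, because h^2 is a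
  multiple of e, and under either \<rho>.\<close>

lemma dim_pure_le:
  assumes "(\<forall>x. \<rho> x = x) \<or> (\<forall>x. \<rho> x = conj x)"
  shows "dim (subalg_gen tw {x}) \<le> 2"
proof -
  define h where "h = x - re x *\<^sub>R e"
  have h: "re h = 0"
    by (simp add: h_def re_diff re_scaleR re_unit)
  have \<rho>: "\<rho> v \<in> span {e, h}" if "v \<in> span {e, h}" for v
    using assms that span_diff[OF span_scale[OF span_base[of e "{e, h}"]] that] by (auto simp: conj_def)
  have mul: "v \<odot> w \<in> span {e, h}" if "v \<in> span {e, h}" "w \<in> span {e, h}" for v w
  proof -
    obtain a b c d where "v = a *\<^sub>R e + b *\<^sub>R h" "w = c *\<^sub>R e + d *\<^sub>R h"
      using \<open>v \<in> _\<close> \<open>w \<in> _\<close> by (auto simp: span_insert algebra_simps)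
    then have "v \<odot> w = (a * c - b * d * (norm h)\<^sup>2) *\<^sub>R e + (a * d + b * c) *\<^sub>R h"
      by (simp add: mul_simps imaginary_square[OF h] algebra_simps)
    then show ?thesis
      by (simp only:) (intro span_add span_scale span_base, auto)
  qed
  have "x = re x *\<^sub>R e + h"
    by (simp add: h_def)
  then have "x \<in> span {e, h}"
    by (metis insertCI span_add span_base span_scale)
  then have "subalg_gen tw {x} \<subseteq> span {e, h}"
    by (intro subalg_gen_minimal) (auto intro: mul \<rho>)
  then have "dim (subalg_gen tw {x}) \<le> card {e, h}"
    by (rule dim_le_card) simp
  also have "\<dots> \<le> 2"
    by (simp add: card_insert_if)
  finally show ?thesis .
qed

lemma untwisted_isomorphic:
  assumes "\<And>x. \<rho> x = x"
  shows "alg_isomorphic tw R_mult \<or> alg_isomorphic tw C_mult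
    \<or> alg_isomorphic tw H_mult \<or> alg_isomorphic tw O_mult"
  using hurwitz
proof (elim disjE exE conjE)
  fix f assume "embedding R_mult id f" "surj f"
  then have "alg_isomorphic tw R_mult"
    by (rule tw_isomorphic_id[where \<sigma> = id]) (simp_all add: assms)
  then show ?thesis by blast
next
  fix f assume "embedding C_mult cnj f" "surj f"
  then have "alg_isomorphic tw C_mult"
    by (rule tw_isomorphic_id[where \<sigma> = id]) (simp_all add: assms)
  then show ?thesis by blast
next
  fix f assume "embedding hmult hconj f" "surj f"
  then have "alg_isomorphic tw H_mult"
    by (rule tw_isomorphic_id[where \<sigma> = id]) (simp_all add: assms H_mult_def)
  then show ?thesis by blast
next
  fix f assume "embedding omult oconj f" "surj f"
  then have "alg_isomorphic tw O_mult"
    by (rule tw_isomorphic_id[where \<sigma> = id]) (simp_all add: assms O_mult_def)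
  then show ?thesis by blast
qed

lemma conj_twisted_isomorphic:
  assumes \<rho>: "\<And>x. \<rho> x = conj x"
  shows "alg_isomorphic tw R_mult \<or> alg_isomorphic tw starC_mult
    \<or> alg_isomorphic tw starH_mult \<or> alg_isomorphic tw starO_mult"
proof -
  have *: "\<rho> (f x) = f (c x)" if "embedding p c f" for p c and f :: "'b::euclidean_space \<Rightarrow> 'a" and x
    using that by (simp add: \<rho> embedding_def)
  show ?thesis
    using hurwitz
  proof (elim disjE exE conjE)
    fix f assume f: "embedding R_mult id f" "surj f"
    \<comment> \<open>On the reals the conjugation is the identity, so no new algebra
      arises.\<close>
    have "alg_isomorphic tw R_mult"
      by (rule tw_isomorphic_id[OF f *[OF f(1)]]) simp
    then show ?thesis by blast
  next
    fix f assume f: "embedding C_mult cnj f" "surj f"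
    have "alg_isomorphic tw starC_mult"
      by (rule tw_isomorphic_id[OF f *[OF f(1)]]) (simp add: starC_mult_def C_mult_def)
    then show ?thesis by blast
  next
    fix f assume f: "embedding hmult hconj f" "surj f"
    have "alg_isomorphic tw starH_mult"
      by (rule tw_isomorphic_id[OF f *[OF f(1)]]) (simp add: starH_mult_def)
    then show ?thesis by blast
  next
    fix f assume f: "embedding omult oconj f" "surj f"
    have "alg_isomorphic tw starO_mult"
      by (rule tw_isomorphic_id[OF f *[OF f(1)]]) (simp add: starO_mult_def)
    then show ?thesis by blast
  qed
qed

section \<open>The mixed case\<close>

text \<open>The complex plane of e and n doubled along l: i goes to n and the new unit to l.\<close>

definition quaternion_map :: "'a \<Rightarrow> 'a \<Rightarrow> complex \<times> complex \<Rightarrow> 'a" where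
  "quaternion_map n l x = (Re (fst x) *\<^sub>R e + Im (fst x) *\<^sub>R n) + (Re (snd x) *\<^sub>R e + Im (snd x) *\<^sub>R n) \<odot> l"

lemma quaternion_map_embedding:
  assumes "norm n = 1" "re n = 0" "norm l = 1" "re l = 0" "ip l n = 0"
  shows "embedding hmult hconj (quaternion_map n l)"
  unfolding quaternion_map_def[abs_def]
  by (rule quaternion_embedding[OF complex_embedding])
    (use assms in \<open>simp_all add: ip_simps ip_commute[of _ e] ip_unit_left\<close>)

context
  fixes p n
  assumes p: "\<rho> p = p" "re p = 0" "norm p = 1" and n: "\<rho> n = - n" "norm n = 1"
begin

lemma mixed_embedding: "embedding hmult hconj (quaternion_map n p)"
  by (rule quaternion_map_embedding[OF n(2) re_skew[OF n(1)] p(3,2) ip_fixed_skew[OF p(1) n(1)]])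

text \<open>Of e, n, p and n p only n is negated.\<close>

lemma \<rho>_mixed_embedding: "\<rho> (quaternion_map n p x) = quaternion_map n p (cnj (fst x), snd x)"
  using p n by (simp add: quaternion_map_def \<rho>_simps mul_simps \<rho>_skew_mul_fixed)

lemma dim_mixed_le: "dim (subalg_gen tw {quaternion_map n p x}) \<le> 4"
proof -
  let ?f = "quaternion_map n p"
  have f: "linear ?f" "?f (hmult x y) = ?f x \<odot> ?f y" for x y
    using mixed_embedding unfolding embedding_def by blast+
  have "subalg_gen tw {?f x} \<subseteq> range ?f"
    by (rule subalg_gen_minimal)
      (auto simp: \<rho>_mixed_embedding linear_subspace_image f simp flip: f(2))
  then have "subalg_gen tw {?f x} \<subseteq> span (?f ` Basis)"
    by (simp add: linear_span_image[OF f(1)] span_Basis)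
  then have "dim (subalg_gen tw {?f x}) \<le> card (?f ` Basis)"
    by (rule dim_le_card) simp
  also have "\<dots> \<le> DIM(complex \<times> complex)"
    by (rule card_image_le) simp
  finally show ?thesis
    by simp
qed

text \<open>Two successive squares of the generator yield e and q = p n, and the generator has an
  n-component besides. Three dimensions already exclude degree at most 2.\<close>

lemma dim_mixed_ge: "3 \<le> dim (subalg_gen tw {p + 2 *\<^sub>R n})"
proof -
  define x where "x = p + 2 *\<^sub>R n"
  define q where "q = p \<odot> n"
  have n0: "re n = 0" "ip p n = 0"
    using p n by (auto intro: re_skew ip_fixed_skew)
  have q: "\<rho> q = q" "re q = 0" "norm q = 1"
    using p n n0 by (simp_all add: q_def \<rho>_fixed_mul_skew norm_mul re_mul_orthogonal)
  define V where "V = subalg_gen tw {x}"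
  have V: "subspace V" "x \<in> V" "a \<in> V \<Longrightarrow> b \<in> V \<Longrightarrow> tw a b \<in> V" for a b
    unfolding V_def by (auto intro: subspace_subalg_gen subalg_gen_base subalg_gen_closed)
  have s: "tw x x = 3 *\<^sub>R e + 4 *\<^sub>R q"
    using square_fixed_add_skew[of p "2 *\<^sub>R n"] p n by (simp add: x_def q_def \<rho>_simps mul_simps)
  have "(- 7) *\<^sub>R e = 9 *\<^sub>R e - 16 *\<^sub>R e" "24 *\<^sub>R q = 12 *\<^sub>R q + 12 *\<^sub>R q"
    by (simp_all flip: scaleR_left.add scaleR_left.diff)
  then have s2: "tw (tw x x) (tw x x) = (- 7) *\<^sub>R e + 24 *\<^sub>R q"
    unfolding s by (simp only:) (simp add: \<rho>_simps q mul_simps imaginary_square algebra_simps)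
  have "(6 / 25) *\<^sub>R tw x x - (1 / 25) *\<^sub>R tw (tw x x) (tw x x) \<in> V"
    using V by (intro subspace_diff subspace_scale) auto
  then have eV: "e \<in> V"
    unfolding s2 unfolding s by (simp add: algebra_simps flip: scaleR_left.add)
  then have "(1 / 4) *\<^sub>R (tw x x - 3 *\<^sub>R e) \<in> V"
    using V by (intro subspace_diff subspace_scale) auto
  then have qV: "q \<in> V"
    by (simp add: s)
  have zero: "ip z w = 0" if "z \<in> span S" "\<And>s. s \<in> S \<Longrightarrow> ip s w = 0" for z w S
    by (rule linear_eq_0_on_span[of "\<lambda>z. ip z w" S]) (use that in \<open>auto simp: ip_simps intro: linearI\<close>)
  have 1: "q \<notin> span {e}"
    using zero[of q "{e}" q] q by (auto simp: ip_unit_left ip_self)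
  have 2: "x \<notin> span {q, e}"
  proof
    assume "x \<in> span {q, e}"
    moreover have "ip s n = 0" if "s \<in> {q, e}" for s
      using that n0 ip_fixed_skew[OF q(1) n(1)] by (auto simp: ip_unit_left)
    ultimately have "ip x n = 0"
      by (rule zero)
    then show False
      using n n0 by (simp add: x_def ip_simps ip_self)
  qed
  have ind: "independent {x, q, e}"
    using 1 2 span_base[of q "{e}"] span_base[of x "{q, e}"] unit_nonzero
    by (auto simp: independent_insert)
  have "q \<noteq> e" "x \<noteq> q" "x \<noteq> e"
    using 1 2 by (auto simp: span_base)
  then have card: "card {x, q, e} = 3"
    by simp
  obtain B where B: "B \<subseteq> V" "independent B" "V \<subseteq> span B" "card B = dim V"
    using basis_exists by blast
  \<comment> \<open>Finite dimension makes B finite; \<open>card\<close> would be 0 for an infinite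
    B.\<close>
  obtain W :: "'a set" where "finite W" "span W = UNIV"
    using finite_dimensional_twisted unfolding finite_dimensional_def by blast
  then have "finite B"
    using independent_span_bound[of W B] B by auto
  then have "card {x, q, e} \<le> card B"
    using independent_span_bound[OF _ ind, of B] B(3) V(2) eV qV by blast
  then show ?thesis
    using card B(4) by (simp add: V_def x_def)
qed

text \<open>Either the quaternions of n and p fill the algebra, or n spans the skew space, or a
  second skew vector gives quaternions on which \<rho> is the conjugation.\<close>

lemma mixed_isomorphic:
  "alg_isomorphic tw starHi1_mult \<or> alg_isomorphic tw starOi1_mult \<or> alg_isomorphic tw tildeO_mult"
proof (cases "surj (quaternion_map n p)")
  case True
  have "alg_isomorphic tw starHi1_mult"
  proof (rule tw_isomorphic)
    show "embedding hmult hconj (quaternion_map n p)"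
      by (rule mixed_embedding)
    show "\<rho> (quaternion_map n p x) = quaternion_map n p ((\<lambda>x. (cnj (fst x), snd x)) x)" for x
      by (simp add: \<rho>_mixed_embedding)
  qed (use True linear_hrot bij_hrot hrot_starHi1_mult in auto)
  then show ?thesis
    by blast
next
  case False
  show ?thesis
  proof (cases "\<forall>n'. \<rho> n' = - n' \<longrightarrow> ip n' n = 0 \<longrightarrow> n' = 0")
    case True
    from obtain_orthogonal[OF mixed_embedding False]
    obtain l where l: "norm l = 1" "ip l (quaternion_map n p x) = 0" for x
      by blast
    note f3 = octonion_embedding[OF mixed_embedding l]
    have "quaternion_map n p (\<i>, 0) = n"
      by (simp add: quaternion_map_def mul_simps)
    then have n_in: "n \<in> range (quaternion_map n p)"
      by (metis rangeI)
    \<comment> \<open>The skew part of such a product is orthogonal to n, so it vanishes when n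
      spans the skew space.\<close>
    have \<rho>l: "\<rho> (quaternion_map n p x \<odot> l) = quaternion_map n p x \<odot> l" for x
    proof -
      let ?z = "quaternion_map n p x \<odot> l"
      have "ip n ?z = 0"
        by (rule ip_new_unit[OF embedding_subalgebra[OF mixed_embedding] l(1)]) (use l n_in in auto)
      then have "ip ?z n = 0"
        by (simp add: ip_commute)
      then have "ip (?z - \<rho> ?z) n = 0"
        by (simp add: ip_diff_left ip_\<rho>_left n ip_minus_right)
      moreover have "\<rho> (?z - \<rho> ?z) = - (?z - \<rho> ?z)"
        by (simp only: \<rho>_simps minus_diff_eq)
      ultimately have "?z - \<rho> ?z = 0"
        using True by blast
      then show ?thesis
        by simp
    qed
    have "alg_isomorphic tw starOi1_mult"
    proof (rule tw_isomorphic[OF f3 octonion_embedding_surj[OF f3]])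
      let ?\<sigma> = "\<lambda>x::oct. ((cnj (fst (fst x)), snd (fst x)), snd x)"
      show "\<rho> (quaternion_map n p (fst x) + quaternion_map n p (snd x) \<odot> l)
        = quaternion_map n p (fst (?\<sigma> x)) + quaternion_map n p (snd (?\<sigma> x)) \<odot> l" for x
        by (simp add: \<rho>_simps \<rho>_mixed_embedding \<rho>l)
    qed (use linear_orot bij_orot orot_starOi1_mult in auto)
    then show ?thesis by blast
  next
    case False
    then obtain n' where n': "\<rho> n' = - n'" "ip n' n = 0" "n' \<noteq> 0"
      by blast
    define n2 where "n2 = (1 / norm n') *\<^sub>R n'"
    have n2: "\<rho> n2 = - n2" "ip n2 n = 0" "norm n2 = 1"
      using n' by (simp_all add: n2_def \<rho>_simps ip_simps)
    \<comment> \<open>Now two orthogonal skew vectors generate the quaternions, and p is the unit to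
      be adjoined.\<close>
    let ?f = "quaternion_map n n2"
    have f2: "embedding hmult hconj ?f"
      by (rule quaternion_map_embedding[OF n(2) re_skew[OF n(1)] n2(3) re_skew[OF n2(1)] n2(2)])
    have \<rho>f: "\<rho> (?f x) = ?f (hconj x)" for x
      using n(1) n2(1) \<rho>_skew_mul_skew[OF n(1) n2(1)] n2(2)
      by (simp add: quaternion_map_def hconj_def \<rho>_simps mul_simps ip_commute[of n n2])
    have skew: "\<rho> (?f x - re (?f x) *\<^sub>R e) = - (?f x - re (?f x) *\<^sub>R e)" for x
    proof -
      have "?f (hconj x) = conj (?f x)"
        using f2 unfolding embedding_def by blast
      then show ?thesis
        by (simp add: \<rho>_simps \<rho>f conj_def algebra_simps) (simp flip: scaleR_2)
    qed
    have orth: "ip p (?f x) = 0" for x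
      using ip_fixed_skew[OF p(1) skew[of x]] p by (simp add: ip_simps ip_commute[of p e] ip_unit_left)
    have \<rho>p: "\<rho> (?f x \<odot> p) = ?f x \<odot> p" for x
      using \<rho>_skew_mul_fixed[OF p(1,2) skew[of x]] p by (simp add: mul_simps \<rho>_simps)
    note f3 = octonion_embedding[OF f2 p(3) orth]
    have "alg_isomorphic tw tildeO_mult"
      by (rule tw_isomorphic_id[OF f3 octonion_embedding_surj[OF f3], where \<sigma> = "\<lambda>x. (hconj (fst x), snd x)"])
        (simp_all add: \<rho>_simps \<rho>f \<rho>p tildeO_mult_def)
    then show ?thesis by blast
  qed
qed

end

section \<open>Assembling the classification\<close>

text \<open>The degree is at most 2 if \<rho> is the identity or the conjugation and at least 3
  otherwise, so one of the two implications is vacuous in each case.\<close>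

lemma twisted_classification:
  "degree tw \<le> 4
    \<and> (degree tw \<le> 2 \<longrightarrow>
         alg_isomorphic tw R_mult \<or> alg_isomorphic tw C_mult \<or> alg_isomorphic tw starC_mult
       \<or> alg_isomorphic tw H_mult \<or> alg_isomorphic tw starH_mult
       \<or> alg_isomorphic tw O_mult \<or> alg_isomorphic tw starO_mult)
    \<and> (degree tw = 4 \<longrightarrow>
         alg_isomorphic tw starHi1_mult \<or> alg_isomorphic tw starOi1_mult
       \<or> alg_isomorphic tw tildeO_mult \<or> alg_isomorphic tw tildeOi_mult)"
proof (cases "(\<forall>x. \<rho> x = x) \<or> (\<forall>x. \<rho> x = conj x)")
  case True
  have "degree tw \<le> 2"
    by (intro degree_le dim_pure_le True)
  then show ?thesis
    using True untwisted_isomorphic conj_twisted_isomorphic by auto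
next
  case False
  then obtain y z where y: "\<rho> y \<noteq> y" and z: "\<rho> z \<noteq> conj z"
    by blast
  define fixed where "fixed x = (1 / 2) *\<^sub>R (x + \<rho> x) - re x *\<^sub>R e" for x
  define skew where "skew x = (1 / 2) *\<^sub>R (x - \<rho> x)" for x
  have f: "\<rho> (fixed x) = fixed x" "re (fixed x) = 0" for x
    by (simp_all add: fixed_def \<rho>_simps re_diff re_scaleR re_add re_\<rho> re_unit add.commute)
  have s: "\<rho> (skew x) = - skew x" for x
    by (simp add: skew_def \<rho>_simps algebra_simps)
  have decomp: "x = re x *\<^sub>R e + fixed x + skew x" for x
    by (simp add: fixed_def skew_def scaleR_2[symmetric] algebra_simps)
  have "skew y \<noteq> 0"
    using y by (auto simp: skew_def)
  have "fixed z \<noteq> 0"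
  proof
    assume "fixed z = 0"
    then have "2 *\<^sub>R fixed z = 0"
      by simp
    then have "z + \<rho> z = (2 * re z) *\<^sub>R e"
      by (simp add: fixed_def algebra_simps)
    with z show False
      by (simp add: conj_def algebra_simps)
  qed
  \<comment> \<open>A unit vector along v, or along the reserve w if v = 0; c will be 1 or -
    1.\<close>
  have dir: "\<exists>u a. \<rho> u = c *\<^sub>R u \<and> re u = 0 \<and> norm u = 1 \<and> v = a *\<^sub>R u"
    if "\<rho> v = c *\<^sub>R v" "re v = 0" "\<rho> w = c *\<^sub>R w" "re w = 0" "w \<noteq> 0" for c v w
  proof (cases "v = 0")
    case True
    then show ?thesis
      using that by (intro exI[of _ "(1 / norm w) *\<^sub>R w"] exI[of _ 0]) (simp add: \<rho>_simps re_scaleR)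
  next
    case False
    then show ?thesis
      using that by (intro exI[of _ "(1 / norm v) *\<^sub>R v"] exI[of _ "norm v"]) (simp add: \<rho>_simps re_scaleR)
  qed
  have le4: "dim (subalg_gen tw {x}) \<le> 4" for x
  proof -
    obtain p a where p: "\<rho> p = p" "re p = 0" "norm p = 1" "fixed x = a *\<^sub>R p"
      using dir[of "fixed x" 1 "fixed z"] f \<open>fixed z \<noteq> 0\<close> by auto
    obtain n b where n: "\<rho> n = - n" "norm n = 1" "skew x = b *\<^sub>R n"
      using dir[of "skew x" "- 1" "skew y"] s re_skew \<open>skew y \<noteq> 0\<close> by auto
    \<comment> \<open>Every x lies in the quaternions of such a pair, with no component along n
      p.\<close>
    have "x = quaternion_map n p (Complex (re x) b, Complex a 0)"
      using decomp[of x] by (simp add: quaternion_map_def mul_simps p n add_ac)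
    then show ?thesis
      using dim_mixed_le[OF p(1-3) n(1,2)] by metis
  qed
  obtain p where p: "\<rho> p = p" "re p = 0" "norm p = 1"
    using dir[of "fixed z" 1 "fixed z"] f \<open>fixed z \<noteq> 0\<close> by auto
  obtain n where n: "\<rho> n = - n" "norm n = 1"
    using dir[of "skew y" "- 1" "skew y"] s re_skew \<open>skew y \<noteq> 0\<close> by auto
  have "3 \<le> degree tw"
    using dim_mixed_ge[OF p n] dim_le_degree[of tw 4, OF le4] order_trans by blast
  then show ?thesis
    using degree_le[of tw 4, OF le4] mixed_isomorphic[OF p n] by auto
qed

end

section \<open>Right multiplication by the left unit\<close>

text \<open>The identity \<open>(x\<^sup>2, x\<^sup>2, x\<^sup>2) = 0\<close> at \<open>x = e + t y\<close>, to first order in \<open>t\<close>.\<close>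
lemma right_mul_unit_involution:
  fixes m :: "'a::real_normed_vector \<Rightarrow> 'a \<Rightarrow> 'a"
  assumes m: "absolute_valued_algebra m" and e: "\<And>x. m e x = x"
    and assoc: "\<And>x. associator m (m x x) (m x x) (m x x) = 0"
  shows "m (m y e) e = y"
proof -
  have bil: "bilinear m" and nrm: "\<And>x y. norm (m x y) = norm x * norm y"
    using m by (auto simp: absolute_valued_algebra_def)
  note m_simps = bilinear_ladd[OF bil] bilinear_radd[OF bil] bilinear_lmul[OF bil] bilinear_rmul[OF bil]
    bilinear_lsub[OF bil] bilinear_rsub[OF bil]
  obtain z :: 'a where "z \<noteq> 0"
    using m by (auto simp: absolute_valued_algebra_def)
  then have e1: "norm e = 1"
    using nrm[of e z] e[of z] by simp
  \<comment> \<open>The square of e + t y is e + t (d + t z), and m d e = d is equivalent to the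
    claim.\<close>
  define d where "d = y + m y e"
  define z where "z = m y y"
  define K where "K = norm d + norm z"
  define C where "C = 6 * K\<^sup>2 + 2 * K ^ 3 + 2 * norm z"
  have bound: "norm (m d e - d) \<le> t * C" if t: "0 < t" "t \<le> 1" for t
  proof -
    define w where "w = d + t *\<^sub>R z"
    have w: "norm w \<le> K"
      unfolding w_def K_def using norm_triangle_ineq[of d "t *\<^sub>R z"] t
        mult_right_mono[of t 1 "norm z"] by simp
    have K: "K \<ge> 0"
      by (simp add: K_def)
    have "m (e + t *\<^sub>R y) (e + t *\<^sub>R y) = e + t *\<^sub>R w"
      by (simp add: m_simps e w_def d_def z_def algebra_simps)
    then have "associator m (e + t *\<^sub>R w) (e + t *\<^sub>R w) (e + t *\<^sub>R w) = 0"
      using assoc by metis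
    \<comment> \<open>Of the three terms linear in t, those with w in second or third place vanish
      because e is a left unit.\<close>
    then have "t *\<^sub>R (m (m w e) e - m w e + t *\<^sub>R (associator m w w e + associator m w e w + associator m e w w)
        + (t * t) *\<^sub>R associator m w w w) = 0"
      by (simp add: associator_def m_simps e algebra_simps)
    then have "m (m w e) e - m w e + (t *\<^sub>R (associator m w w e + associator m w e w + associator m e w w)
        + (t * t) *\<^sub>R associator m w w w) = 0"
      using t by (simp add: add.assoc)
    then have "m (m w e) e - m w e = - (t *\<^sub>R (associator m w w e + associator m w e w + associator m e w w)
        + (t * t) *\<^sub>R associator m w w w)"
      by (simp only: eq_neg_iff_add_eq_0)
    \<comment> \<open>Right multiplication by e is isometric, so one factor e cancels.\<close>
    moreover have "norm (m (m w e) e - m w e) = norm (m w e - w)"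
      by (simp flip: bilinear_lsub[OF bil] add: nrm e1)
    ultimately have "norm (m w e - w)
      = norm (t *\<^sub>R (associator m w w e + associator m w e w + associator m e w w) + (t * t) *\<^sub>R associator m w w w)"
      by (metis norm_minus_cancel)
    also have "\<dots> \<le> t * (2 * K\<^sup>2 + 2 * K\<^sup>2 + 2 * K\<^sup>2) + t * t * (2 * K ^ 3)"
    proof -
      have ass: "norm (associator m a b c) \<le> 2 * (norm a * norm b * norm c)" for a b c
        using norm_triangle_ineq4[of "m (m a b) c" "m a (m b c)"] by (simp add: associator_def nrm)
      have K2: "norm w * norm w \<le> K\<^sup>2"
        unfolding power2_eq_square using w K by (intro mult_mono) auto
      moreover have "norm w * norm w * norm w \<le> K ^ 3"
        unfolding power3_eq_cube using w K by (intro mult_mono) auto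
      ultimately have b: "norm (associator m w w e) \<le> 2 * K\<^sup>2" "norm (associator m w e w) \<le> 2 * K\<^sup>2"
        "norm (associator m e w w) \<le> 2 * K\<^sup>2" "norm (associator m w w w) \<le> 2 * K ^ 3"
        using ass[of w w e] ass[of w e w] ass[of e w w] ass[of w w w] by (simp_all add: e1)
      have "norm (associator m w w e + associator m w e w + associator m e w w) \<le> 2 * K\<^sup>2 + 2 * K\<^sup>2 + 2 * K\<^sup>2"
        by (intro norm_triangle_le add_mono b)
      then have "t * norm (associator m w w e + associator m w e w + associator m e w w)
          \<le> t * (2 * K\<^sup>2 + 2 * K\<^sup>2 + 2 * K\<^sup>2)"
        using t by (intro mult_left_mono) auto
      moreover have "t * t * norm (associator m w w w) \<le> t * t * (2 * K ^ 3)"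
        using t b(4) by (intro mult_left_mono) auto
      ultimately show ?thesis
        using t by (intro norm_triangle_le) (simp only: norm_scaleR abs_mult abs_of_pos add_mono)
    qed
    also have "\<dots> \<le> t * (6 * K\<^sup>2 + 2 * K ^ 3)"
      using t K mult_right_mono[of "t * t" "t" "2 * K ^ 3"] by (simp add: algebra_simps mult_left_le)
    finally have 1: "norm (m w e - w) \<le> t * (6 * K\<^sup>2 + 2 * K ^ 3)" .
    have "m d e - d = (m w e - w) - t *\<^sub>R (m z e - z)"
      by (simp add: w_def m_simps algebra_simps)
    then have "norm (m d e - d) \<le> norm (m w e - w) + t * norm (m z e - z)"
      using norm_triangle_ineq4[of "m w e - w" "t *\<^sub>R (m z e - z)"] t by simp
    moreover have "t * norm (m z e - z) \<le> t * (2 * norm z)"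
      using norm_triangle_ineq4[of "m z e" z] t by (intro mult_left_mono) (auto simp: nrm e1)
    ultimately show ?thesis
      using 1 by (simp add: C_def algebra_simps)
  qed
  have "norm (m d e - d) \<le> 0"
  proof (rule tendsto_lowerbound)
    show "((\<lambda>t. t * C) \<longlongrightarrow> 0) (at_right 0)"
      by (auto intro!: tendsto_eq_intros)
    show "\<forall>\<^sub>F t in at_right 0. norm (m d e - d) \<le> t * C"
      using bound by (auto simp: eventually_at_right_field intro: exI[of _ 1])
  qed simp
  then show ?thesis
    by (simp add: d_def m_simps)
qed

theorem theorem5:
  fixes m :: "'a::real_normed_vector \<Rightarrow> 'a \<Rightarrow> 'a"
  assumes "absolute_valued_algebra m"
    and "has_left_unit m"
    and "\<forall>x. let s = m x x in associator m s s s = 0"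
  shows "finite_dimensional TYPE('a) \<and> degree m \<le> 4
    \<and> (degree m \<le> 2 \<longrightarrow>
         alg_isomorphic m R_mult \<or> alg_isomorphic m C_mult \<or> alg_isomorphic m starC_mult
       \<or> alg_isomorphic m H_mult \<or> alg_isomorphic m starH_mult
       \<or> alg_isomorphic m O_mult \<or> alg_isomorphic m starO_mult)
    \<and> (degree m = 4 \<longrightarrow>
         alg_isomorphic m starHi1_mult \<or> alg_isomorphic m starOi1_mult
       \<or> alg_isomorphic m tildeO_mult \<or> alg_isomorphic m tildeOi_mult)"
proof -
  obtain e where e: "m e x = x" for x
    using assms(2) by (auto simp: has_left_unit_def)
  have bil: "bilinear m" and nrm: "norm (m x y) = norm x * norm y" for x y
    using assms(1) by (auto simp: absolute_valued_algebra_def)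
  obtain z :: 'a where z: "z \<noteq> 0"
    using assms(1) by (auto simp: absolute_valued_algebra_def)
  then have e1: "norm e = 1"
    using nrm[of e z] e[of z] by simp
  have assoc: "associator m (m x x) (m x x) (m x x) = 0" for x
    using assms(3) by (simp add: Let_def)
  define \<rho> where "\<rho> x = m x e" for x
  have \<rho>\<rho>: "\<rho> (\<rho> x) = x" for x
    unfolding \<rho>_def using right_mul_unit_involution[OF assms(1) e assoc] .
  have lin: "linear \<rho>"
    unfolding \<rho>_def using bil by (simp add: bilinear_def)
  \<comment> \<open>Since \<rho> is an involution, twisting the first argument makes e a right unit
    as well, and twisting again returns m.\<close>
  define mul where "mul x y = m (\<rho> x) y" for x y
  interpret twisted_absolute_valued mul e \<rho>
  proof
    show "bilinear mul"
      unfolding mul_def bilinear_def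
      using bil lin by (auto simp: bilinear_def intro: linear_compose[OF lin, unfolded o_def])
    show "mul x e = x" for x
      using \<rho>\<rho>[of x] by (simp add: mul_def \<rho>_def)
    show "mul (\<rho> (mul (\<rho> s) s)) s = mul (\<rho> s) (mul (\<rho> s) s)" if "s = mul (\<rho> x) x" for s x
      using assoc[of x] that by (simp add: mul_def \<rho>\<rho> associator_def)
    show "\<rho> (x + y) = \<rho> x + \<rho> y" "\<rho> (c *\<^sub>R x) = c *\<^sub>R \<rho> x" for x y c
      using lin by (simp_all add: linear_add linear_scale)
    show "\<rho> (\<rho> x) = x" for x
      by (rule \<rho>\<rho>)
  qed (use e1 in \<open>auto simp: mul_def \<rho>_def nrm e\<close>)
  have "tw = m"
    by (simp add: mul_def \<rho>\<rho> fun_eq_iff)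
  then show ?thesis
    using twisted_classification finite_dimensional_twisted by simp
qed

end
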